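(* Let $d\ge2$ be an integer. There are constants $c_d,b_d>0$, an unbounded sequence of scales $N>0$, and, for each $N$ in this sequence, a trigonometric polynomial $F_N$ on $\mathbb{T}^d$ and a nonempty finite set $B_N\subseteq(0,1/2]$ such that $$\operatorname{supp}\widehat{F_N}\subseteq\{n\in\mathbb{Z}^d: N\le|n|\le2N\},\qquad \|F_N\|_{L^2(\mathbb{T}^d)}=1,$$ and $$\left|\left\{x\in\mathbb{T}^d:\ \max_{t\in B_N}|e^{it\Delta}F_N(x)|\ge c_dN^{\frac{d}{d+2}}\right\}\right|\ge b_d.$$
   Context: $\mathbb{T}^d=(\mathbb{R}/2\pi\mathbb{Z})^d$ carries normalized Haar measure $(2\pi)^{-d}\,dx$, used both for $|A|$ (the measure of a set $A$) and for the $L^2$ norm. Fourier coefficients are $\widehat f(n)=(2\pi)^{-d}\int_{[0,2\pi)^d}f(x)e^{-in\cdot x}\,dx$, $n\in\mathbb{Z}^d$; thus $\|f\|_{L^2}^2=\sum_n|\widehat f(n)|^2$. $|n|$ is the Euclidean length. A trigonometric polynomial is a finite complex linear combination of the functions $x\mapsto e^{in\cdot x}$, $n\in\mathbb{Z}^d$, and for such $f$ one sets $e^{it\Delta}f(x)=\sum_{n\in\mathbb{Z}^d}\widehat f(n)e^{i(n\cdot x-t|n|^2)}$. The constants $c_d,b_d$ depend only on $d$, not on $N$. *)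

theory Defs
  imports "HOL-Analysis.Analysis"
begin

text \<open>
  The torus of dimension \<open>CARD('n)\<close> is represented by its fundamental domain \<open>[0, 2\<pi>)\<^sup>d\<close>:
  functions on it are \<open>2\<pi>\<close>-periodic functions on \<open>real ^ 'n\<close> (trigonometric
  polynomials and their evolutions have this periodicity automatically), and normalized Haar measure is
  \<open>(2\<pi>)\<^sup>-\<^sup>d dx\<close> carried by that domain.
\<close>

definition torus_box :: "(real ^ 'n) set" where
  "torus_box = {x. \<forall>i. 0 \<le> x $ i \<and> x $ i < 2 * pi}"

definition haar_torus :: "(real ^ 'n) measure" where
  "haar_torus = density lborel (\<lambda>x. ennreal (indicator torus_box x / (2 * pi) ^ CARD('n)))"

definition freq :: "int ^ 'n \<Rightarrow> real ^ 'n" where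
  "freq n = (\<chi> i. real_of_int (n $ i))"

definition fourier_coeff :: "(real ^ 'n \<Rightarrow> complex) \<Rightarrow> int ^ 'n \<Rightarrow> complex" where
  "fourier_coeff f n = (LINT x|haar_torus. f x * exp (- \<i> * of_real (freq n \<bullet> x)))"

definition L2_norm_torus :: "(real ^ 'n \<Rightarrow> complex) \<Rightarrow> real" where
  "L2_norm_torus f = sqrt (LINT x|haar_torus. (cmod (f x))\<^sup>2)"

definition trig_polynomial :: "(real ^ 'n \<Rightarrow> complex) \<Rightarrow> bool" where
  "trig_polynomial f \<longleftrightarrow>
     (\<exists>S a. finite S \<and> f = (\<lambda>x. \<Sum>n\<in>S. a n * exp (\<i> * of_real (freq n \<bullet> x))))"

text \<open>Only used for trigonometric polynomials, where the sum has finitely many nonzero terms.\<close>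

definition schrodinger :: "real \<Rightarrow> (real ^ 'n \<Rightarrow> complex) \<Rightarrow> real ^ 'n \<Rightarrow> complex" where
  "schrodinger t f x =
     (\<Sum>\<^sub>\<infinity>n. fourier_coeff f n * exp (\<i> * of_real (freq n \<bullet> x - t * (norm (freq n))\<^sup>2)))"

end

theory Submission
  imports Defs
begin

text \<open>
  Write \<open>d\<close> for the dimension. For the full Weyl sum over all frequencies of size \<open>N\<close>, the points where
  \<open>e\<^bsup>it\<Delta>\<^esup>F\<close> is large at a time \<open>2\<pi>a/q\<close> do not depend on \<open>a\<close>, so that most times are wasted.
  Restricting the frequencies to a coset of an isotropic lattice makes these points move with \<open>a\<close>.

  Take \<open>p\<close> a power of \<open>5\<close>, \<open>q = p\<^sup>2\<^sup>d\<close>, and \<open>N\<close> comparable to \<open>p\<^bsup>d+2\<^esup>\<close>. Let \<open>M\<close> be a lattice in \<open>\<int>\<^sup>d\<close> of index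
  \<open>q\<^bsup>d/2\<^esup>\<close> with \<open>|u|\<^sup>2 \<equiv> 0\<close> modulo \<open>q\<close> for all \<open>u \<in> M\<close>, and similar to \<open>\<int>\<^sup>d\<close>. The coordinates are grouped in pairs,
  where \<open>M\<close> is the ideal of \<open>\<int>[i]\<close> generated by a power of \<open>2 + i\<close> of norm \<open>q\<close>; in odd dimension the remaining
  coordinate is a multiple of \<open>p\<^sup>d\<close>. Let \<open>F\<close> be the normalized sum of the characters with frequency \<open>n \<in> w + M\<close>
  in a rotated cube of side and distance from the origin comparable to \<open>N\<close>; their number is of the order of
  \<open>N\<^sup>d/q\<^bsup>d/2\<^esup>\<close>, that is of \<open>p\<^sup>2\<^sup>d\<close>. For \<open>n = w + u\<close> one has \<open>|n|\<^sup>2 \<equiv> |w|\<^sup>2 + 2w \<bullet> u\<close>, so at the time \<open>2\<pi>a/q\<close> the Schroedinger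
  phase is linear in \<open>u\<close>: all characters are aligned at the points \<open>2\<pi>b/q\<close> with \<open>b \<in> 2aw + M\<close> (\<open>coherence\<close>),
  and the modulus stays comparable to \<open>p\<^sup>d\<close>, hence to \<open>N\<^bsup>d/(d+2)\<^esup>\<close>, on a ball of radius comparable to \<open>1/N\<close>
  around each of them (\<open>large_maximal_function\<close>).

  A fixed proportion of the \<open>q\<close> values of \<open>a\<close> gives times in \<open>(0, 1/2]\<close>, and each of them has \<open>q\<^bsup>d/2\<^esup>\<close> such
  points, which makes about \<open>q\<^bsup>d/2+1\<^esup> = p\<^bsup>d(d+2)\<^esup>\<close>, that is \<open>N\<^sup>d\<close> up to a constant, balls of radius about
  \<open>1/N\<close>. They cover a fixed proportion of the torus as soon as they are disjoint, and this depends on the choice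
  of \<open>w\<close>. The class of \<open>w\<close> modulo \<open>M\<close> is given by a residue for each pair and each unpaired coordinate; these
  are taken to be powers of \<open>p\<close>, spaced so that each coordinate controls its own window of base-\<open>p\<close> digits of
  \<open>a\<close>, as in a digit expansion. If \<open>a \<noteq> a'\<close>, the lowest digit where they differ lies in one of the windows and
  separates the corresponding points there (\<open>separation\<close>).
\<close>

section \<open>Trigonometric polynomials on the torus\<close>

lemma integral_exp_circle:
  fixes k :: int
  shows "(LINT t|lborel. indicator {0..<2 * pi} t * exp (\<i> * of_real (of_int k * t)))
           = (if k = 0 then of_real (2 * pi) else 0 :: complex)"
    and "integrable lborel (\<lambda>t::real. indicator {0..<2 * pi} t * exp (\<i> * of_real (of_int k * t)) :: complex)"
proof -
  have "has_bochner_integral lborel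
      (\<lambda>t. indicator {0..2 * pi} t *\<^sub>R exp (\<i> * of_real (of_int k * t)) :: complex)
      (if k = 0 then of_real (2 * pi) else 0)"
  proof (cases "k = 0")
    case True
    have "has_bochner_integral lborel (indicator {0..2*pi} :: real \<Rightarrow> real) (measure lborel {0..2*pi})"
      by (rule has_bochner_integral_real_indicator) auto
    from has_bochner_integral_scaleR_left[OF this, of "1::complex"]
    show ?thesis using True by (simp add: scaleR_conv_of_real)
  next
    case False
    let ?F = "\<lambda>t::real. exp (\<i> * of_real (of_int k * t)) / (\<i> * of_int k) :: complex"
    have "has_bochner_integral lborel
      (\<lambda>t. indicator {0..2 * pi} t *\<^sub>R exp (\<i> * of_real (of_int k * t)) :: complex) (?F (2*pi) - ?F 0)"
    proof (rule has_bochner_integral_FTC_Icc)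
      show "(?F has_vector_derivative exp (\<i> * of_real (of_int k * t))) (at t within {0..2*pi})" for t
        using False
        by (auto intro!: derivative_eq_intros has_vector_derivative_real_field simp: field_simps)
      show "continuous_on {0..2*pi} (\<lambda>t::real. exp (\<i> * of_real (of_int k * t)) :: complex)"
        by (intro continuous_intros)
    qed auto
    moreover have "exp (\<i> * of_real (of_int k * (2 * pi))) = (1::complex)"
      by (simp add: exp_eq_1)
    ultimately show ?thesis using False by simp
  qed
  moreover have "AE t in lborel. indicator {0..2 * pi} t *\<^sub>R exp (\<i> * of_real (of_int k * t))
       = (indicator {0..<2 * pi} t * exp (\<i> * of_real (of_int k * t)) :: complex)"
    using AE_lborel_singleton[of "2*pi"] by eventually_elim (auto simp: indicator_def)
  ultimately have *: "has_bochner_integral lborel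
      (\<lambda>t. indicator {0..<2 * pi} t * exp (\<i> * of_real (of_int k * t)) :: complex)
      (if k = 0 then of_real (2 * pi) else 0)"
    by (subst (asm) has_bochner_integral_cong_AE) auto
  show "(LINT t|lborel. indicator {0..<2 * pi} t * exp (\<i> * of_real (of_int k * t)))
           = (if k = 0 then of_real (2 * pi) else 0 :: complex)"
    using * by (rule has_bochner_integral_integral_eq)
  show "integrable lborel (\<lambda>t::real. indicator {0..<2 * pi} t * exp (\<i> * of_real (of_int k * t)) :: complex)"
    using * by (rule integrable.intros)
qed

text \<open>Fubini for products of functions of one coordinate each.\<close>

lemma integral_lborel_vec_prod:
  fixes g :: "'n::finite \<Rightarrow> real \<Rightarrow> complex"
  assumes "\<And>i. integrable lborel (g i)"
  shows "(LINT x|lborel. (\<Prod>i\<in>UNIV. g i (x $ i))) = (\<Prod>i\<in>UNIV. LINT t|lborel. g i t)"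
proof -
  interpret product_sigma_finite "\<lambda>b::real^'n. lborel :: real measure" ..
  define h where "h b = g (SOME i. b = axis i 1)" for b :: "real^'n"
  have h: "h (axis i 1) = g i" for i
    unfolding h_def by (rule arg_cong[of _ _ g]) (auto simp: axis_eq_axis)
  have B: "(Basis :: (real^'n) set) = range (\<lambda>i. axis i 1)"
    by (auto simp: Basis_vec_def)
  have inj: "inj (\<lambda>i::'n. axis i (1::real))"
    by (auto simp: inj_def axis_eq_axis)
  have pr: "(\<Prod>b\<in>Basis. k b) = (\<Prod>i\<in>UNIV. k (axis i 1))" for k :: "real^'n \<Rightarrow> complex"
    unfolding B by (subst prod.reindex[OF inj]) simp
  have meas: "(\<lambda>x::real^'n. (\<Prod>i\<in>UNIV. g i (x $ i))) \<in> borel_measurable borel"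
  proof -
    have [measurable]: "g i \<in> borel_measurable borel" for i
      using assms[of i] by auto
    show ?thesis by measurable
  qed
  have "(LINT x|lborel. (\<Prod>i\<in>UNIV. g i (x $ i)))
     = (LINT f|(\<Pi>\<^sub>M b\<in>(Basis::(real^'n) set). lborel).
           (\<Prod>i\<in>UNIV. g i ((\<Sum>b\<in>Basis. f b *\<^sub>R b) $ i)))"
    by (subst lborel_eq, subst integral_distr) (use meas in \<open>auto\<close>)
  also have "\<dots> = (LINT f|(\<Pi>\<^sub>M b\<in>(Basis::(real^'n) set). lborel). (\<Prod>b\<in>Basis. h b (f b)))"
  proof (rule Bochner_Integration.integral_cong[OF refl])
    fix f :: "real^'n \<Rightarrow> real"
    have "(\<Sum>b\<in>Basis. f b *\<^sub>R b) $ i = f (axis i 1)" for i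
      unfolding B by (subst sum.reindex[OF inj])
        (simp add: axis_def if_distrib[of "\<lambda>z. _ * z"] cong: if_cong)
    then show "(\<Prod>i\<in>UNIV. g i ((\<Sum>b\<in>Basis. f b *\<^sub>R b) $ i)) = (\<Prod>b\<in>Basis. h b (f b))"
      by (simp add: pr h)
  qed
  also have "\<dots> = (\<Prod>b\<in>Basis. LINT t|lborel. h b t)"
    by (rule product_integral_prod) (auto simp: B h assms)
  also have "\<dots> = (\<Prod>i\<in>UNIV. LINT t|lborel. g i t)"
    by (simp add: pr h)
  finally show ?thesis .
qed

lemma torus_box_measurable [measurable]: "(torus_box :: (real^'n::finite) set) \<in> sets borel"
  unfolding torus_box_def by measurable

lemma sets_haar_torus [measurable_cong, simp]: "sets haar_torus = sets borel"
  by (simp add: haar_torus_def)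

lemma space_haar_torus [simp]: "space haar_torus = UNIV"
  by (simp add: haar_torus_def)

lemma integral_haar_torus:
  fixes g :: "real^'n::finite \<Rightarrow> complex"
  assumes [measurable]: "g \<in> borel_measurable borel"
  shows "(LINT x|haar_torus. g x)
           = (LINT x|lborel. indicator torus_box x * g x) / (2 * pi) ^ CARD('n)"
  unfolding haar_torus_def
  by (subst integral_density)
     (auto simp: scaleR_conv_of_real of_real_divide indicator_def if_distrib
       simp flip: integral_divide_zero cong: if_cong intro!: Bochner_Integration.integral_cong)

lemma emeasure_haar_torus:
  fixes X :: "(real^'n::finite) set"
  assumes [measurable]: "X \<in> sets borel" and "X \<subseteq> torus_box"
  shows "emeasure haar_torus X = emeasure lborel X / ennreal ((2 * pi) ^ CARD('n))"
proof -
  have "emeasure haar_torus X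
      = (\<integral>\<^sup>+x. ennreal (indicator torus_box x / (2 * pi) ^ CARD('n)) * indicator X x \<partial>lborel)"
    unfolding haar_torus_def by (rule emeasure_density) auto
  also have "\<dots> = (\<integral>\<^sup>+x. ennreal (1 / (2 * pi) ^ CARD('n)) * indicator X x \<partial>lborel)"
    using assms(2) by (intro nn_integral_cong) (auto simp: indicator_def)
  also have "\<dots> = ennreal (1 / (2 * pi) ^ CARD('n)) * emeasure lborel X"
    by (rule nn_integral_cmult_indicator) auto
  finally show ?thesis
    by (simp add: divide_ennreal_def mult.commute inverse_ennreal inverse_eq_divide)
qed

lemma integral_character:
  fixes n :: "int^'n::finite"
  shows "(LINT x|haar_torus. exp (\<i> * of_real (freq n \<bullet> x))) = (if n = 0 then 1 else 0 :: complex)"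
proof -
  have ind: "(indicator torus_box x :: complex) = (\<Prod>i\<in>UNIV. indicator {0..<2*pi} (x $ i))"
    for x :: "real^'n"
  proof (cases "x \<in> torus_box")
    case True
    then show ?thesis by (auto simp: torus_box_def indicator_def)
  next
    case False
    then obtain i where "x $ i \<notin> {0..<2*pi}" by (auto simp: torus_box_def not_le not_less)
    then have "(\<Prod>i\<in>UNIV. indicator {0..<2*pi} (x $ i)) = (0::complex)"
      by (intro prod_zero) (auto simp: indicator_def)
    with False show ?thesis by simp
  qed
  have "(LINT x|haar_torus. exp (\<i> * of_real (freq n \<bullet> x)) :: complex)
     = (LINT x|lborel. indicator torus_box x * exp (\<i> * of_real (freq n \<bullet> x))) / (2 * pi) ^ CARD('n)"
    by (rule integral_haar_torus) measurable
  also have "(LINT x|lborel. indicator torus_box x * exp (\<i> * of_real (freq n \<bullet> x)) :: complex)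
     = (LINT x|lborel. (\<Prod>i\<in>UNIV. indicator {0..<2*pi} (x $ i) * exp (\<i> * of_real (of_int (n $ i) * (x $ i)))))"
    by (intro Bochner_Integration.integral_cong refl)
       (simp add: ind prod.distrib freq_def inner_vec_def sum_distrib_left exp_sum)
  also have "\<dots> = (\<Prod>i\<in>UNIV. LINT t|lborel. indicator {0..<2*pi} t * exp (\<i> * of_real (of_int (n $ i) * t)))"
    by (rule integral_lborel_vec_prod) (rule integral_exp_circle)
  also have "\<dots> = (if n = 0 then of_real (2 * pi) ^ CARD('n) else 0)"
  proof (cases "n = 0")
    case False
    then obtain i where "n $ i \<noteq> 0" by (auto simp: vec_eq_iff)
    with False show ?thesis
      unfolding integral_exp_circle by (simp, blast)
  qed (unfold integral_exp_circle, simp)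
  finally show ?thesis by simp
qed

lemma finite_measure_haar_torus: "finite_measure (haar_torus :: (real^'n::finite) measure)"
proof
  have "emeasure (haar_torus :: (real^'n) measure) (space haar_torus) = emeasure (haar_torus :: (real^'n) measure) torus_box"
    unfolding haar_torus_def by (auto simp: emeasure_density indicator_def intro!: nn_integral_cong)
  also have "\<dots> = emeasure lborel (torus_box :: (real^'n) set) / ennreal ((2 * pi) ^ CARD('n))"
    by (rule emeasure_haar_torus) auto
  also have "\<dots> \<noteq> \<infinity>"
  proof -
    have "(torus_box :: (real^'n) set) \<subseteq> cbox 0 (\<chi> i. 2 * pi)"
      by (auto simp: torus_box_def mem_box_cart less_imp_le)
    then have "emeasure lborel (torus_box :: (real^'n) set) < \<infinity>"
      using emeasure_mono[of torus_box "cbox 0 (\<chi> i. 2 * pi) :: (real^'n) set" lborel] emeasure_lborel_cbox_finite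
      by (auto intro: le_less_trans)
    then show ?thesis
      by (simp add: ennreal_divide_eq_top_iff less_top)
  qed
  finally show "emeasure (haar_torus :: (real^'n) measure) (space haar_torus) \<noteq> \<infinity>" .
qed

lemma integrable_character:
  "integrable haar_torus (\<lambda>x::real^'n::finite. exp (\<i> * of_real (freq n \<bullet> x)) :: complex)"
  using finite_measure_haar_torus
  by (rule finite_measure.integrable_const_bound[where B = 1]) auto

lemma freq_diff: "freq (m - n) = freq m - freq n"
  by (simp add: freq_def vec_eq_iff)

lemma trig_sum_times_character:
  "(\<Sum>n\<in>S. a n * exp (\<i> * of_real (freq n \<bullet> x))) * exp (- \<i> * of_real (freq m \<bullet> x))
     = (\<Sum>n\<in>S. a n * exp (\<i> * of_real (freq (n - m) \<bullet> x)))"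
  unfolding sum_distrib_right
  by (intro sum.cong refl) (simp add: freq_diff inner_diff_left right_diff_distrib exp_diff exp_minus field_simps)

lemma fourier_coeff_trig_sum:
  fixes S :: "(int^'n::finite) set"
  assumes "finite S"
  shows "fourier_coeff (\<lambda>x. \<Sum>n\<in>S. a n * exp (\<i> * of_real (freq n \<bullet> x))) m = (if m \<in> S then a m else 0)"
proof -
  have "fourier_coeff (\<lambda>x. \<Sum>n\<in>S. a n * exp (\<i> * of_real (freq n \<bullet> x))) m
     = (LINT x|haar_torus. (\<Sum>n\<in>S. a n * exp (\<i> * of_real (freq (n - m) \<bullet> x))))"
    unfolding fourier_coeff_def trig_sum_times_character ..
  also have "\<dots> = (\<Sum>n\<in>S. LINT x|haar_torus. a n * exp (\<i> * of_real (freq (n - m) \<bullet> x)))"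
    by (intro Bochner_Integration.integral_sum integrable_mult_right integrable_character)
  also have "\<dots> = (\<Sum>n\<in>S. if n = m then a n else 0)"
    by (intro sum.cong refl) (simp add: integral_character)
  finally show ?thesis using assms by simp
qed

lemma L2_norm_trig_sum:
  fixes S :: "(int^'n::finite) set"
  assumes "finite S"
  shows "L2_norm_torus (\<lambda>x. \<Sum>n\<in>S. a n * exp (\<i> * of_real (freq n \<bullet> x))) = sqrt (\<Sum>n\<in>S. (cmod (a n))\<^sup>2)"
proof -
  let ?F = "\<lambda>x::real^'n. \<Sum>n\<in>S. a n * exp (\<i> * of_real (freq n \<bullet> x))"
  have "of_real (LINT x|haar_torus. (cmod (?F x))\<^sup>2) = (LINT x|haar_torus. (of_real ((cmod (?F x))\<^sup>2) :: complex))"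
    by (rule integral_complex_of_real[symmetric])
  also have "\<dots> = (LINT x|haar_torus. (\<Sum>m\<in>S. cnj (a m) * (?F x * exp (- \<i> * of_real (freq m \<bullet> x)))))"
  proof (rule Bochner_Integration.integral_cong[OF refl])
    fix x :: "real^'n"
    have "of_real ((cmod (?F x))\<^sup>2) = ?F x * cnj (?F x)"
      by (rule complex_norm_square)
    also have "cnj (?F x) = (\<Sum>m\<in>S. cnj (a m) * exp (- \<i> * of_real (freq m \<bullet> x)))"
      by (simp add: exp_cnj)
    finally show "of_real ((cmod (?F x))\<^sup>2) = (\<Sum>m\<in>S. cnj (a m) * (?F x * exp (- \<i> * of_real (freq m \<bullet> x))))"
      by (simp add: sum_distrib_left ac_simps)
  qed
  also have "\<dots> = (\<Sum>m\<in>S. LINT x|haar_torus. cnj (a m) * (?F x * exp (- \<i> * of_real (freq m \<bullet> x))))"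
  proof (intro Bochner_Integration.integral_sum integrable_mult_right)
    fix m
    have "integrable haar_torus (\<lambda>x. \<Sum>n\<in>S. a n * exp (\<i> * of_real (freq (n - m) \<bullet> x)))"
      by (intro Bochner_Integration.integrable_sum integrable_mult_right integrable_character)
    then show "integrable haar_torus (\<lambda>x. ?F x * exp (- \<i> * of_real (freq m \<bullet> x)))"
      unfolding trig_sum_times_character .
  qed
  also have "\<dots> = (\<Sum>m\<in>S. cnj (a m) * fourier_coeff ?F m)"
    by (simp add: fourier_coeff_def)
  also have "\<dots> = (\<Sum>m\<in>S. of_real ((cmod (a m))\<^sup>2))"
    by (intro sum.cong refl) (simp add: fourier_coeff_trig_sum[OF assms] mult.commute flip: complex_norm_square)
  finally have "(LINT x|haar_torus. (cmod (?F x))\<^sup>2) = (\<Sum>m\<in>S. (cmod (a m))\<^sup>2)"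
    by (simp only: of_real_eq_iff flip: of_real_sum)
  then show ?thesis by (simp add: L2_norm_torus_def)
qed

lemma schrodinger_trig_sum:
  fixes S :: "(int^'n::finite) set"
  assumes "finite S"
  shows "schrodinger t (\<lambda>x. \<Sum>n\<in>S. a n * exp (\<i> * of_real (freq n \<bullet> x))) x
     = (\<Sum>n\<in>S. a n * exp (\<i> * of_real (freq n \<bullet> x - t * (norm (freq n))\<^sup>2)))"
proof -
  have "schrodinger t (\<lambda>x. \<Sum>n\<in>S. a n * exp (\<i> * of_real (freq n \<bullet> x))) x
     = (\<Sum>\<^sub>\<infinity>n\<in>S. a n * exp (\<i> * of_real (freq n \<bullet> x - t * (norm (freq n))\<^sup>2)))"
    unfolding schrodinger_def
    by (rule infsum_cong_neutral) (auto simp: fourier_coeff_trig_sum[OF assms])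
  with assms show ?thesis by simp
qed

section \<open>Arithmetic coherence produces large values\<close>

lemma freq_add: "freq (m + n) = freq m + freq n"
  by (simp add: freq_def vec_eq_iff)

lemma finite_cube: "finite {c :: int^'n::finite. \<forall>i. l \<le> c $ i \<and> c $ i < u}"
proof (rule finite_subset)
  show "{c :: int^'n. \<forall>i. l \<le> c $ i \<and> c $ i < u} \<subseteq> vec_lambda ` (UNIV \<rightarrow>\<^sub>E {l..<u})"
    by (auto intro!: image_eqI[of _ _ "vec_nth _"])
qed (auto intro!: finite_PiE)

lemma card_cube: "card {c :: int^'n::finite. \<forall>i. l \<le> c $ i \<and> c $ i < u} = nat (u - l) ^ CARD('n)"
proof -
  have "{c :: int^'n. \<forall>i. l \<le> c $ i \<and> c $ i < u} = vec_lambda ` (UNIV \<rightarrow>\<^sub>E {l..<u})"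
    by (auto intro!: image_eqI[of _ _ "vec_nth _"])
  then have "card {c :: int^'n. \<forall>i. l \<le> c $ i \<and> c $ i < u} = card ((UNIV :: 'n set) \<rightarrow>\<^sub>E {l..<u})"
    by (simp add: card_image inj_on_def vec_lambda_inject)
  then show ?thesis by (simp add: card_PiE)
qed

lemma norm_squared_vec: "(norm (v :: real^'n::finite))\<^sup>2 = (\<Sum>i\<in>UNIV. (v $ i)\<^sup>2)"
  unfolding power2_norm_eq_inner inner_vec_def by (simp add: power2_eq_square)

lemma cmod_sum_cis_ge:
  assumes "\<And>n. n \<in> S \<Longrightarrow> \<bar>\<phi> n\<bar> \<le> pi / 3"
  shows "real (card S) / 2 \<le> cmod (\<Sum>n\<in>S. exp (\<i> * of_real (\<phi> n)))"
proof -
  have "1 / 2 \<le> cos (\<phi> n)" if "n \<in> S" for n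
  proof -
    have "cos (pi / 3) \<le> cos \<bar>\<phi> n\<bar>"
      using assms[OF that] by (intro cos_monotone_0_pi_le) auto
    then show ?thesis by (simp add: cos_60)
  qed
  then have "(\<Sum>n\<in>S. 1 / 2) \<le> (\<Sum>n\<in>S. cos (\<phi> n))"
    by (intro sum_mono) auto
  also have "\<dots> = Re (\<Sum>n\<in>S. exp (\<i> * of_real (\<phi> n)))"
    by (simp add: Re_exp)
  also have "\<dots> \<le> cmod (\<Sum>n\<in>S. exp (\<i> * of_real (\<phi> n)))"
    by (rule complex_Re_le_cmod)
  finally show ?thesis by simp
qed

text \<open>
  The time is \<open>2\<pi>a/q\<close>. At the point \<open>2\<pi>b/q\<close> the phase of the frequency \<open>n\<close> is
  \<open>2\<pi>/q\<close> times \<open>b \<bullet> n - a|n|\<^sup>2\<close>, so if this integer has the same residue \<open>\<theta>\<close> modulo \<open>q\<close> for all \<open>n \<in> S\<close>,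
  all terms are aligned there, and remain within \<open>\<pi>/3\<close> of alignment at nearby points \<open>x\<close>.
\<close>

lemma schrodinger_large_near_coherent_point:
  fixes S :: "(int^'n::finite) set" and b :: "int^'n" and a q \<theta> :: int
  assumes S: "finite S" "S \<noteq> {}" and q: "q > 0"
    and coh: "\<And>n. n \<in> S \<Longrightarrow> q dvd (\<Sum>i\<in>UNIV. b $ i * n $ i) - a * (\<Sum>i\<in>UNIV. (n $ i)\<^sup>2) - \<theta>"
    and near: "\<And>n. n \<in> S \<Longrightarrow> \<bar>freq n \<bullet> (x - (2 * pi / q) *\<^sub>R freq b)\<bar> \<le> pi / 3"
  shows "sqrt (card S) / 2
    \<le> cmod (schrodinger (2 * pi * a / q)
         (\<lambda>x. \<Sum>n\<in>S. of_real (1 / sqrt (card S)) * exp (\<i> * of_real (freq n \<bullet> x))) x)"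
proof -
  let ?\<delta> = "x - (2 * pi / q) *\<^sub>R freq b"
  define u where "u = exp (\<i> * of_real (2 * pi * \<theta> / q))"
  have phase: "exp (\<i> * of_real (freq n \<bullet> x - 2 * pi * a / q * (norm (freq n))\<^sup>2))
      = u * exp (\<i> * of_real (freq n \<bullet> ?\<delta>))" if n: "n \<in> S" for n
  proof -
    obtain k where k: "(\<Sum>i\<in>UNIV. b $ i * n $ i) - a * (\<Sum>i\<in>UNIV. (n $ i)\<^sup>2) - \<theta> = q * k"
      using coh[OF n] by (auto elim: dvdE)
    have nb: "freq n \<bullet> freq b = of_int (\<Sum>i\<in>UNIV. b $ i * n $ i)"
      by (simp add: freq_def inner_vec_def mult.commute)
    have nn: "(norm (freq n))\<^sup>2 = of_int (\<Sum>i\<in>UNIV. (n $ i)\<^sup>2)"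
      unfolding norm_squared_vec by (simp add: freq_def)
    have "freq n \<bullet> freq b - a * (norm (freq n))\<^sup>2 = \<theta> + q * k"
      unfolding nb nn using arg_cong[OF k, of real_of_int] by simp
    then have e: "freq n \<bullet> freq b = \<theta> + q * k + a * (norm (freq n))\<^sup>2" by simp
    have "freq n \<bullet> x - 2 * pi * a / q * (norm (freq n))\<^sup>2
        = freq n \<bullet> ?\<delta> + 2 * pi / q * (\<theta> + q * k)"
      unfolding inner_diff_right inner_scaleR_right e
      using q by (simp add: algebra_simps add_divide_distrib)
    also have "\<dots> = freq n \<bullet> ?\<delta> + 2 * pi * \<theta> / q + 2 * pi * k"
      using q by (simp add: field_simps)
    finally have "exp (\<i> * of_real (freq n \<bullet> x - 2 * pi * a / q * (norm (freq n))\<^sup>2))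
      = exp (\<i> * of_real (freq n \<bullet> ?\<delta>)) * u * exp (\<i> * (of_int k * (of_real pi * 2)))"
      by (simp add: u_def distrib_left exp_add mult_ac)
    then show ?thesis by (simp add: mult.commute)
  qed
  have "real (card S) / 2 \<le> cmod (\<Sum>n\<in>S. exp (\<i> * of_real (freq n \<bullet> ?\<delta>)))"
    by (rule cmod_sum_cis_ge) (rule near)
  then have "1 / sqrt (card S) * (real (card S) / 2) \<le> 1 / sqrt (card S) * cmod (\<Sum>n\<in>S. exp (\<i> * of_real (freq n \<bullet> ?\<delta>)))"
    by (intro mult_left_mono) auto
  also have "1 / sqrt (card S) * (real (card S) / 2) = sqrt (card S) / 2"
    by (simp add: real_div_sqrt)
  also have "1 / sqrt (card S) * cmod (\<Sum>n\<in>S. exp (\<i> * of_real (freq n \<bullet> ?\<delta>)))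
    = cmod (schrodinger (2 * pi * a / q)
         (\<lambda>x. \<Sum>n\<in>S. of_real (1 / sqrt (card S)) * exp (\<i> * of_real (freq n \<bullet> x))) x)"
  proof -
    have "(\<Sum>n\<in>S. of_real (1 / sqrt (card S)) * exp (\<i> * of_real (freq n \<bullet> x - 2 * pi * a / q * (norm (freq n))\<^sup>2)))
        = of_real (1 / sqrt (card S)) * (u * (\<Sum>n\<in>S. exp (\<i> * of_real (freq n \<bullet> ?\<delta>))))"
      unfolding sum_distrib_left by (intro sum.cong refl) (simp only: phase)
    then show ?thesis
      unfolding schrodinger_trig_sum[OF S(1)]
      by (simp add: norm_mult norm_divide u_def)
  qed
  finally show ?thesis .
qed

text \<open>
  The lattice of mesh \<open>2\<pi>/q\<close> cuts the torus into \<open>q\<^sup>d\<close> cells; open cells are used, which loses only a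
  null set.
\<close>

lemma measure_haar_torus_cells:
  fixes G :: "(int^'n::finite) set" and q :: int
  assumes q: "q > 0" and G: "\<And>c i. c \<in> G \<Longrightarrow> 0 \<le> c $ i \<and> c $ i < q"
  defines "cell \<equiv> (\<lambda>c. box ((2 * pi / q) *\<^sub>R freq c) ((2 * pi / q) *\<^sub>R freq (c + 1)))"
  shows "measure haar_torus (\<Union>c\<in>G. cell c) = card G / q ^ CARD('n)"
    and "(\<Union>c\<in>G. cell c) \<subseteq> torus_box"
proof -
  interpret finite_measure "haar_torus :: (real^'n) measure" by (rule finite_measure_haar_torus)
  have mem: "x \<in> cell c \<longleftrightarrow> (\<forall>i. of_int (c $ i) < x $ i * (q / (2 * pi)) \<and> x $ i * (q / (2 * pi)) < of_int (c $ i) + 1)"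
    for x c
    using q by (simp add: cell_def mem_box_cart freq_def field_simps)
  have fin: "finite G"
    by (rule finite_subset[OF _ finite_cube[of 0 q]]) (use G in auto)
  have disj: "disjoint_family_on cell G"
    unfolding disjoint_family_on_def
  proof (intro ballI impI, rule ccontr)
    fix c c' assume "c \<noteq> c'" "cell c \<inter> cell c' \<noteq> {}"
    then obtain x where "x \<in> cell c" "x \<in> cell c'" by auto
    then have "c $ i = c' $ i" for i
      unfolding mem by (metis floor_unique less_imp_le)
    with \<open>c \<noteq> c'\<close> show False by (simp add: vec_eq_iff)
  qed
  have sub: "cell c \<subseteq> torus_box" if "c \<in> G" for c
  proof
    fix x assume x: "x \<in> cell c"
    have "0 \<le> x $ i \<and> x $ i < 2 * pi" for i
    proof -
      have "of_int (c $ i) < x $ i * (q / (2 * pi))" "x $ i * (q / (2 * pi)) < of_int (c $ i) + 1"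
        using x unfolding mem by auto
      moreover have "0 \<le> real_of_int (c $ i)" "real_of_int (c $ i) + 1 \<le> q"
        using G[OF that, of i] by linarith+
      ultimately have "0 < x $ i * (q / (2 * pi))" "x $ i * (q / (2 * pi)) < q"
        by linarith+
      then show ?thesis using q by (simp add: field_simps zero_less_mult_iff zero_less_divide_iff)
    qed
    then show "x \<in> torus_box" by (simp add: torus_box_def)
  qed
  then show "(\<Union>c\<in>G. cell c) \<subseteq> torus_box" by auto
  have one: "measure haar_torus (cell c) = 1 / q ^ CARD('n)" if "c \<in> G" for c
  proof -
    have "measure lborel (cell c) = (\<Prod>b\<in>(Basis :: (real^'n) set). 2 * pi / q)"
    proof -
      have d: "(2 * pi / q) *\<^sub>R freq (c + 1) - (2 * pi / q) *\<^sub>R freq c = (2 * pi / q) *\<^sub>R (1 :: real^'n)"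
        by (simp add: freq_def vec_eq_iff distrib_left add_divide_distrib)
      have b: "(1 :: real^'n) \<bullet> b = 1" if "b \<in> Basis" for b
        using that by (auto simp: Basis_vec_def inner_axis)
      show ?thesis
        unfolding cell_def
      proof (subst measure_lborel_box)
        show "(2 * pi / q) *\<^sub>R freq c \<bullet> b \<le> (2 * pi / q) *\<^sub>R freq (c + 1) \<bullet> b" if "b \<in> Basis" for b
        proof -
          have "0 \<le> ((2 * pi / q) *\<^sub>R freq (c + 1) - (2 * pi / q) *\<^sub>R freq c) \<bullet> b"
            unfolding d using q b[OF that] by simp
          then show ?thesis by (simp add: inner_diff_left)
        qed
        show "(\<Prod>b\<in>Basis. ((2 * pi / q) *\<^sub>R freq (c + 1) - (2 * pi / q) *\<^sub>R freq c) \<bullet> b) = (\<Prod>b\<in>(Basis :: (real^'n) set). 2 * pi / q)"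
          unfolding d by (intro prod.cong refl) (simp add: b)
      qed
    qed
    then have L: "measure lborel (cell c) = (2 * pi / q) ^ CARD('n)" by simp
    have "emeasure haar_torus (cell c) = emeasure lborel (cell c) / ennreal ((2 * pi) ^ CARD('n))"
      by (rule emeasure_haar_torus) (use sub[OF that] in \<open>auto simp: cell_def\<close>)
    also have "emeasure lborel (cell c) = ennreal ((2 * pi / q) ^ CARD('n))"
      unfolding L[symmetric] by (rule emeasure_eq_ennreal_measure)
        (use emeasure_lborel_box_finite in \<open>auto simp: cell_def less_top[symmetric] top_unique\<close>)
    also have "\<dots> / ennreal ((2 * pi) ^ CARD('n)) = ennreal (1 / q ^ CARD('n))"
      using q by (subst divide_ennreal) (auto simp: power_divide)
    finally show ?thesis using q by (simp add: measure_def)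
  qed
  have "measure haar_torus (\<Union>c\<in>G. cell c) = (\<Sum>c\<in>G. measure haar_torus (cell c))"
    by (rule finite_measure_finite_Union[OF fin _ disj]) (auto simp: cell_def)
  then show "measure haar_torus (\<Union>c\<in>G. cell c) = card G / q ^ CARD('n)"
    by (simp add: one)
qed

text \<open>
  A mesh cell with lower corner \<open>c\<close> counts as good if some coherent point \<open>b\<close>, for one of the times
  \<open>2\<pi>a/q\<close> with \<open>1 \<le> a \<le> T\<close>, satisfies \<open>0 \<le> c - b < H\<close> in every coordinate. On a good cell the
  distance to \<open>2\<pi>b/q\<close> is at most \<open>\<surd>d \<cdot> 2\<pi>H/q\<close>, and the hypothesis \<open>small\<close> turns this into
  phase errors of at most \<open>\<pi>/3\<close>.
\<close>

lemma large_maximal_function: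
  fixes S G :: "(int^'n::finite) set" and q T H :: int and M :: real
  assumes S: "finite S" "S \<noteq> {}" and q: "q > 0" and T: "T > 0"
    and G: "\<And>c i. c \<in> G \<Longrightarrow> 0 \<le> c $ i \<and> c $ i < q"
    and coh: "\<And>c. c \<in> G \<Longrightarrow> \<exists>a\<in>{1..T}. \<exists>b \<theta>. (\<forall>i. b $ i \<le> c $ i \<and> c $ i - b $ i < H) \<and>
       (\<forall>n\<in>S. q dvd (\<Sum>i\<in>UNIV. b $ i * n $ i) - a * (\<Sum>i\<in>UNIV. (n $ i)\<^sup>2) - \<theta>)"
    and norm: "\<And>n. n \<in> S \<Longrightarrow> norm (freq n) \<le> M"
    and small: "6 * M * sqrt (CARD('n)) * H \<le> q"
  defines "F \<equiv> (\<lambda>x. \<Sum>n\<in>S. of_real (1 / sqrt (card S)) * exp (\<i> * of_real (freq n \<bullet> x)))"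
    and "B \<equiv> (\<lambda>a. 2 * pi * a / q) ` real_of_int ` {1..T}"
  shows "card G / q ^ CARD('n)
    \<le> measure haar_torus {x \<in> torus_box. sqrt (card S) / 2 \<le> Max ((\<lambda>t. cmod (schrodinger t F x)) ` B)}"
proof -
  interpret finite_measure "haar_torus :: (real^'n) measure" by (rule finite_measure_haar_torus)
  let ?cell = "\<lambda>c. box ((2 * pi / q) *\<^sub>R freq c) ((2 * pi / q) *\<^sub>R freq (c + 1)) :: (real^'n) set"
  let ?E = "{x \<in> torus_box. sqrt (card S) / 2 \<le> Max ((\<lambda>t. cmod (schrodinger t F x)) ` B)}"
  have B: "finite B" "B \<noteq> {}" using T by (auto simp: B_def)
  have Max_iff: "l \<le> Max ((\<lambda>t. cmod (schrodinger t F x)) ` B) \<longleftrightarrow> (\<exists>t\<in>B. l \<le> cmod (schrodinger t F x))" for l x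
    using B by (subst Max_ge_iff) auto
  have "?E = torus_box \<inter> (\<Union>t\<in>B. {x. sqrt (card S) / 2 \<le> cmod (schrodinger t F x)})"
    unfolding Max_iff by auto
  also have "\<dots> \<in> sets borel"
  proof -
    have "{x. sqrt (card S) / 2 \<le> cmod (schrodinger t F x)} \<in> sets borel" for t
      unfolding F_def schrodinger_trig_sum[OF S(1)]
      by (intro borel_closed closed_Collect_le continuous_intros)
    then show ?thesis using B by auto
  qed
  finally have E: "?E \<in> sets borel" .
  have "(\<Union>c\<in>G. ?cell c) \<subseteq> ?E"
  proof
    fix x assume "x \<in> (\<Union>c\<in>G. ?cell c)"
    then obtain c where c: "c \<in> G" "x \<in> ?cell c" by auto
    from coh[OF c(1)] obtain a b \<theta> where a: "a \<in> {1..T}"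
      and b: "\<And>i. b $ i \<le> c $ i \<and> c $ i - b $ i < H"
      and cong: "\<And>n. n \<in> S \<Longrightarrow> q dvd (\<Sum>i\<in>UNIV. b $ i * n $ i) - a * (\<Sum>i\<in>UNIV. (n $ i)\<^sup>2) - \<theta>"
      by blast
    define \<delta> where "\<delta> = x - (2 * pi / q) *\<^sub>R freq b"
    have b1: "c $ i + 1 - b $ i \<le> H" for i using b[of i] by linarith
    have H: "0 \<le> H" using b[of undefined] by linarith
    have \<delta>: "\<bar>\<delta> $ i\<bar> \<le> 2 * pi / q * H" for i
    proof -
      have lo: "2 * pi / q * c $ i < x $ i" and hi: "x $ i < 2 * pi / q * (c $ i + 1)"
        using c(2) by (auto simp: mem_box_cart freq_def)
      have "2 * pi / q * b $ i \<le> 2 * pi / q * c $ i"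
        using b[of i] q by (intro mult_left_mono) auto
      moreover have "2 * pi / q * (c $ i + 1 - b $ i) \<le> 2 * pi / q * H"
        using b1[of i] q by (intro mult_left_mono) (simp_all only: of_int_le_iff, simp)
      ultimately show ?thesis
        using lo hi by (simp add: \<delta>_def freq_def right_diff_distrib)
    qed
    have "norm \<delta> \<le> sqrt (CARD('n)) * (2 * pi / q * H)"
    proof -
      have "(norm \<delta>)\<^sup>2 = (\<Sum>i\<in>UNIV. (\<delta> $ i)\<^sup>2)"
        by (rule norm_squared_vec)
      also have "\<dots> \<le> (\<Sum>i\<in>(UNIV::'n set). (2 * pi / q * H)\<^sup>2)"
        using \<delta> by (intro sum_mono) (metis abs_ge_zero power2_abs power_mono)
      also have "\<dots> = (sqrt (CARD('n)) * (2 * pi / q * H))\<^sup>2"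
        by (simp only: power_mult_distrib[of "sqrt _"]) simp
      finally show ?thesis by (rule power2_le_imp_le) (use q H in auto)
    qed
    then have near: "\<bar>freq n \<bullet> \<delta>\<bar> \<le> pi / 3" if "n \<in> S" for n
    proof -
      have "\<bar>freq n \<bullet> \<delta>\<bar> \<le> norm (freq n) * norm \<delta>" by (rule Cauchy_Schwarz_ineq2)
      also have "\<dots> \<le> M * (sqrt (CARD('n)) * (2 * pi / q * H))"
        using norm[OF that] \<open>norm \<delta> \<le> _\<close> order_trans[OF norm_ge_zero norm[OF that]] by (intro mult_mono) auto
      also have "\<dots> = (6 * M * sqrt (CARD('n)) * H) * (pi / (3 * q))"
        by (simp add: field_simps)
      also have "\<dots> \<le> q * (pi / (3 * q))"
        using small q by (intro mult_right_mono) auto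
      also have "\<dots> = pi / 3" using q by simp
      finally show ?thesis .
    qed
    have "sqrt (card S) / 2 \<le> cmod (schrodinger (2 * pi * a / q) F x)"
      unfolding F_def
      by (rule schrodinger_large_near_coherent_point[OF S q cong]) (use near in \<open>auto simp: \<delta>_def\<close>)
    moreover have "2 * pi * a / q \<in> B" using a by (auto simp: B_def)
    moreover have "x \<in> torus_box"
      using measure_haar_torus_cells(2)[OF q G] c by auto
    ultimately show "x \<in> ?E" unfolding mem_Collect_eq Max_iff by blast
  qed
  then have "measure haar_torus (\<Union>c\<in>G. ?cell c) \<le> measure haar_torus ?E"
    by (rule finite_measure_mono) (use E in simp)
  moreover have "measure haar_torus (\<Union>c\<in>G. ?cell c) = card G / q ^ CARD('n)"
    by (rule measure_haar_torus_cells(1)[OF q G])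
  ultimately show ?thesis by simp
qed

section \<open>Resonant lattices\<close>

text \<open>
  The coordinates are grouped into pairs \<open>{i, pr i}\<close>, one for each \<open>i \<in> A\<close>, and unpaired
  coordinates \<open>R\<close>. Even and odd dimensions are then treated alike, with \<open>R\<close> empty or a singleton.
  The values of \<open>pr\<close> on \<open>R\<close> are irrelevant.
\<close>

locale paired_coordinates =
  fixes pr :: "'n::finite \<Rightarrow> 'n" and A R :: "'n set"
  assumes pr_pr [simp]: "pr (pr i) = i"
    and pr_notin: "i \<in> A \<Longrightarrow> pr i \<notin> A" "i \<in> A \<Longrightarrow> pr i \<notin> R"
    and A_R: "i \<in> A \<Longrightarrow> i \<notin> R"
    and cover: "i \<notin> A \<Longrightarrow> i \<notin> R \<Longrightarrow> pr i \<in> A"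
begin

lemma inj_pr: "inj pr"
  by (metis injI pr_pr)

lemma UNIV_split: "UNIV = A \<union> pr ` A \<union> R"
  using cover by (metis (no_types, opaque_lifting) UNIV_eq_I Un_iff image_eqI pr_pr)

lemma sum_split:
  fixes h :: "'n \<Rightarrow> 'b::comm_monoid_add"
  shows "(\<Sum>i\<in>UNIV. h i) = (\<Sum>i\<in>A. h i + h (pr i)) + (\<Sum>i\<in>R. h i)"
proof -
  have "(\<Sum>i\<in>UNIV. h i) = (\<Sum>i\<in>A. h i) + (\<Sum>i\<in>pr ` A. h i) + (\<Sum>i\<in>R. h i)"
    unfolding UNIV_split
    by (subst sum.union_disjoint, simp, simp, use pr_notin A_R in blast)+ simp
  also have "(\<Sum>i\<in>pr ` A. h i) = (\<Sum>i\<in>A. h (pr i))"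
    by (subst sum.reindex) (auto intro: inj_on_subset[OF inj_pr])
  finally show ?thesis by (simp add: sum.distrib)
qed

lemma prod_split:
  fixes h :: "'n \<Rightarrow> 'b::comm_monoid_mult"
  shows "(\<Prod>i\<in>UNIV. h i) = (\<Prod>i\<in>A. h i * h (pr i)) * (\<Prod>i\<in>R. h i)"
proof -
  have "(\<Prod>i\<in>UNIV. h i) = (\<Prod>i\<in>A. h i) * (\<Prod>i\<in>pr ` A. h i) * (\<Prod>i\<in>R. h i)"
    unfolding UNIV_split
    by (subst prod.union_disjoint, simp, simp, use pr_notin A_R in blast)+ simp
  also have "(\<Prod>i\<in>pr ` A. h i) = (\<Prod>i\<in>A. h (pr i))"
    by (subst prod.reindex) (auto intro: inj_on_subset[OF inj_pr])
  finally show ?thesis by (simp add: prod.distrib)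
qed

lemma card_split: "2 * card A + card R = CARD('n)"
  using sum_split[of "\<lambda>_. 1::nat"] by simp

end

lemma ex_paired_coordinates:
  "\<exists>(pr :: 'n::finite \<Rightarrow> 'n) A R. paired_coordinates pr A R \<and> card R \<le> 1"
proof -
  obtain A :: "'n set" where A: "card A = CARD('n) div 2" "finite A"
    by (rule obtain_subset_with_card_n[of "CARD('n) div 2" "UNIV :: 'n set"]) auto
  have "CARD('n) div 2 \<le> card (- A)"
    using A by (simp add: Compl_eq_Diff_UNIV card_Diff_subset)
  then obtain A' where A': "A' \<subseteq> - A" "card A' = CARD('n) div 2" "finite A'"
    by (rule obtain_subset_with_card_n)
  from A A' obtain g where g: "bij_betw g A A'"
    by (metis finite_same_card_bij)
  define pr where "pr i = (if i \<in> A then g i else if i \<in> A' then inv_into A g i else i)" for i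
  have 1: "pr i \<in> A'" "pr (pr i) = i" if "i \<in> A" for i
    using that g A' by (auto simp: pr_def bij_betw_def)
  have 2: "pr i \<in> A" "pr (pr i) = i" if "i \<in> A'" for i
  proof -
    have "i \<notin> A" using that A' by auto
    then have e: "pr i = inv_into A g i" using that by (simp add: pr_def)
    have "i \<in> g ` A" using that g by (simp add: bij_betw_def)
    then show "pr i \<in> A" "pr (pr i) = i"
      unfolding e by (auto simp: pr_def inv_into_into f_inv_into_f)
  qed
  have 3: "pr i = i" if "i \<notin> A" "i \<notin> A'" for i
    using that by (simp add: pr_def)
  have "paired_coordinates pr A (- (A \<union> A'))"
  proof
    show "pr (pr i) = i" for i using 1 2 3 by metis
    show "pr i \<notin> A" "pr i \<notin> - (A \<union> A')" if "i \<in> A" for i using 1(1)[OF that] A' by auto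
    show "i \<notin> - (A \<union> A')" if "i \<in> A" for i using that by simp
    show "pr i \<in> A" if "i \<notin> A" "i \<notin> - (A \<union> A')" for i using that 2(1)[of i] by auto
  qed
  moreover have "card (- (A \<union> A')) \<le> 1"
  proof -
    have "card (A \<union> A') = CARD('n) div 2 + CARD('n) div 2"
      using A A' by (subst card_Un_disjoint) auto
    then show ?thesis by (simp add: Compl_eq_Diff_UNIV card_Diff_subset)
  qed
  ultimately show ?thesis by blast
qed

text \<open>
  Here \<open>\<iota>\<close> is a square root of \<open>-1\<close> modulo \<open>p\<^sup>2\<^sup>d\<close>, and \<open>(x, y)\<close> is a vector of length \<open>p\<^sup>d\<close> on the line
  \<open>v\<^sub>2 \<equiv> \<iota>v\<^sub>1\<close>, which is isotropic for \<open>v\<^sub>1\<^sup>2 + v\<^sub>2\<^sup>2\<close> modulo \<open>p\<^sup>2\<^sup>d\<close>. The function \<open>k\<close> numbers the pairs.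
\<close>

locale resonant_lattice = paired_coordinates pr A R
  for pr :: "'n::finite \<Rightarrow> 'n" and A R :: "'n set" +
  fixes p x y \<iota> :: int and k :: "'n \<Rightarrow> nat"
  assumes p: "p \<ge> 2" and dim: "CARD('n) \<ge> 2" and card_R: "card R \<le> 1"
    and k: "bij_betw k A {..<card A}"
    and xy: "x\<^sup>2 + y\<^sup>2 = p ^ (2 * CARD('n))"
    and iota_x: "p ^ (2 * CARD('n)) dvd y - \<iota> * x"
    and iota_sq: "p ^ (2 * CARD('n)) dvd \<iota>\<^sup>2 + 1"
begin

text \<open>The modulus \<open>q\<close> is the denominator of the times; \<open>s\<close> is its square root.\<close>

definition s :: int where "s = p ^ CARD('n)"

definition q :: int where "q = p ^ (2 * CARD('n))"

text \<open>
  The coefficients of the linear forms below. Up to a common factor \<open>\<tau>\<close>, they spread the base-\<open>p\<close>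
  digits of \<open>\<tau>\<close> over the coordinates: the pair number \<open>j\<close> detects the four digits at the places
  \<open>2d - 4 - 4j, \<dots>, 2d - 1 - 4j\<close>, and the unpaired coordinate, if there is one, the remaining two digits
  at the places \<open>0\<close> and \<open>1\<close>.
\<close>

definition \<omega> :: "'n \<Rightarrow> int" where
  "\<omega> i = (if i \<in> R then p ^ (CARD('n) - 2) else p ^ (4 * k i))"

text \<open>
  \<open>L 0\<close> is a lattice of index \<open>q\<^bsup>d/2\<^esup>\<close> on which \<open>|v|\<^sup>2\<close> vanishes modulo \<open>q\<close>, and \<open>L \<tau>\<close> is its coset that
  is \<open>\<tau>\<close> times the coset \<open>L 1\<close>. Frequencies are taken from \<open>L 1\<close>; the points \<open>2\<pi>b/q\<close> with \<open>b \<in> L (2a)\<close>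
  are those where they are coherent at the time \<open>2\<pi>a/q\<close>.
\<close>

definition L :: "int \<Rightarrow> (int^'n) set" where
  "L \<tau> = {v. (\<forall>i\<in>A. q dvd v $ i + \<iota> * v $ pr i - \<tau> * \<omega> i) \<and> (\<forall>i\<in>R. s dvd v $ i - \<tau> * \<omega> i)}"

lemma q_pos: "q > 0" and s_pos: "s > 0"
  using p by (simp_all add: q_def s_def)

lemma q_eq: "q = s * s"
  by (simp add: q_def s_def mult_2 power_add)

text \<open>Modulo \<open>p\<^sup>g\<close> the quadratic form factors as \<open>v\<^sup>2 + w\<^sup>2 \<equiv> (v + \<iota>w)(v - \<iota>w)\<close>.\<close>

lemma dvd_norm_of_form:
  assumes "g \<le> 2 * CARD('n)" "p ^ g dvd v + \<iota> * w"
  shows "p ^ g dvd v\<^sup>2 + w\<^sup>2"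
proof -
  have i: "p ^ g dvd \<iota>\<^sup>2 + 1"
    using iota_sq assms(1) by (meson dvd_trans le_imp_power_dvd)
  have "p ^ g dvd (v + \<iota> * w) * (v - \<iota> * w) + (\<iota>\<^sup>2 + 1) * w\<^sup>2"
    by (rule dvd_add[OF dvd_mult2[OF assms(2)] dvd_mult2[OF i]])
  also have "(v + \<iota> * w) * (v - \<iota> * w) + (\<iota>\<^sup>2 + 1) * w\<^sup>2 = v\<^sup>2 + w\<^sup>2"
    by algebra
  finally show ?thesis .
qed

lemma pair_zero:
  assumes "p ^ (2 * (CARD('n) - 2)) dvd v + \<iota> * w"
    and v: "2 * \<bar>v\<bar> < p ^ (CARD('n) - 2)" and w: "2 * \<bar>w\<bar> < p ^ (CARD('n) - 2)"
  shows "v = 0 \<and> w = 0"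
proof -
  define P where "P = p ^ (CARD('n) - 2)"
  have P: "p ^ (2 * (CARD('n) - 2)) = P\<^sup>2"
    by (simp add: P_def flip: power_mult) (simp add: mult.commute)
  have "P\<^sup>2 dvd v\<^sup>2 + w\<^sup>2"
    using dvd_norm_of_form[of "2 * (CARD('n) - 2)" v w] assms(1) P by simp
  moreover have "v\<^sup>2 + w\<^sup>2 < P\<^sup>2"
  proof -
    have "(2 * \<bar>v\<bar>)\<^sup>2 < P\<^sup>2" "(2 * \<bar>w\<bar>)\<^sup>2 < P\<^sup>2"
      using v w unfolding P_def[symmetric] by (intro power_strict_mono; simp)+
    then have "4 * v\<^sup>2 < P\<^sup>2" "4 * w\<^sup>2 < P\<^sup>2"
      by (simp_all add: power_mult_distrib)
    moreover have "0 \<le> v\<^sup>2" by simp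
    ultimately show ?thesis by linarith
  qed
  ultimately have "v\<^sup>2 + w\<^sup>2 = 0"
    using zdvd_imp_le[of "P\<^sup>2" "v\<^sup>2 + w\<^sup>2"] by (smt (verit) zero_le_power2)
  then show ?thesis by (simp add: sum_power2_eq_zero_iff)
qed

text \<open>
  The cosets \<open>L \<tau>\<close> for \<open>|\<tau>| < q\<close> contain no vector other than \<open>0\<close> with all coordinates below
  \<open>p\<^bsup>d-2\<^esup>/2\<close>, so coherent points that belong to different times stay apart. Let \<open>p\<^sup>e\<close> be the exact power of \<open>p\<close>
  in \<open>\<tau>\<close>. The place \<open>e\<close> is detected by some pair or by the unpaired coordinate, and there the linear form
  is divisible by a large power of \<open>p\<close> but is not \<open>0\<close> modulo \<open>q\<close> (or \<open>s\<close>). Small coordinates would have to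
  vanish by the divisibility, and then the form would vanish too. For \<open>\<tau> = 0\<close> the divisibility alone suffices.
\<close>

lemma separation:
  assumes v: "v \<in> L \<tau>" and \<tau>: "\<bar>\<tau>\<bar> < q" and small: "\<And>i. 2 * \<bar>v $ i\<bar> < p ^ (CARD('n) - 2)"
  shows "\<tau> = 0 \<and> v = 0"
proof -
  have vA: "q dvd v $ i + \<iota> * v $ pr i - \<tau> * \<omega> i" if "i \<in> A" for i
    using v that by (auto simp: L_def)
  have vR: "s dvd v $ i - \<tau> * \<omega> i" if "i \<in> R" for i
    using v that by (auto simp: L_def)
  have le: "p ^ (2 * (CARD('n) - 2)) dvd q" "p ^ (CARD('n) - 2) dvd s"
    by (simp_all add: q_def s_def le_imp_power_dvd)
  have R_zero: "v $ i = 0" if "p ^ (CARD('n) - 2) dvd v $ i" for i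
  proof (rule ccontr)
    assume "v $ i \<noteq> 0"
    then have "p ^ (CARD('n) - 2) \<le> \<bar>v $ i\<bar>"
      using that by (intro zdvd_imp_le) auto
    then show False using small[of i] by linarith
  qed
  have "\<tau> = 0"
  proof (rule ccontr)
    assume "\<tau> \<noteq> 0"
    define e where "e = multiplicity p \<tau>"
    have e: "p ^ e dvd \<tau>" "\<And>m. p ^ m dvd \<tau> \<Longrightarrow> m \<le> e"
      using \<open>\<tau> \<noteq> 0\<close> p by (auto simp: e_def multiplicity_dvd intro!: multiplicity_geI)
    have "e < 2 * CARD('n)"
    proof (rule ccontr)
      assume "\<not> e < 2 * CARD('n)"
      then have "q dvd \<tau>" using e(1) unfolding q_def by (meson dvd_trans le_imp_power_dvd not_le)
      then show False using \<tau> \<open>\<tau> \<noteq> 0\<close> zdvd_imp_le[of q "\<bar>\<tau>\<bar>"] by auto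
    qed
    show False
    proof (cases "e < 2 * card R")
      case True
      then have "card R = 1" "e \<le> 1" using card_R by auto
      then obtain i where i: "i \<in> R" by (auto simp: card_Suc_eq)
      have "\<omega> i = p ^ (CARD('n) - 2)" using i by (simp add: \<omega>_def)
      with vR[OF i] have *: "s dvd v $ i - \<tau> * p ^ (CARD('n) - 2)" by simp
      have "p ^ (CARD('n) - 2) dvd v $ i"
        using dvd_add[OF dvd_trans[OF le(2) *] dvd_triv_right[of "p ^ (CARD('n) - 2)" \<tau>]] by simp
      then have "v $ i = 0" by (rule R_zero)
      with * have "s dvd \<tau> * p ^ (CARD('n) - 2)" by simp
      moreover have "s = p ^ 2 * p ^ (CARD('n) - 2)"
        unfolding s_def using dim by (metis le_add_diff_inverse power_add)
      ultimately have "p ^ 2 dvd \<tau>" using p by simp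
      with e(2) \<open>e \<le> 1\<close> show False by fastforce
    next
      case False
      \<comment> \<open>The pair whose window of four places contains the place \<open>e\<close>.\<close>
      define D where "D = 2 * CARD('n) - 1 - e"
      define j where "j = D div 4"
      have cA: "2 * CARD('n) = 4 * card A + 2 * card R" using card_split by simp
      have j: "j < card A" "4 * j + e < 2 * CARD('n)" "2 * (CARD('n) - 2) \<le> 4 * j + e"
      proof -
        have "D + e + 1 = 2 * CARD('n)" using \<open>e < 2 * CARD('n)\<close> by (simp add: D_def)
        moreover have "4 * j \<le> D" "D < 4 * j + 4" unfolding j_def by linarith+
        moreover have "2 * (CARD('n) - 2) + 4 = 2 * CARD('n)" using dim by simp
        ultimately show "j < card A" "4 * j + e < 2 * CARD('n)" "2 * (CARD('n) - 2) \<le> 4 * j + e"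
          using False cA by linarith+
      qed
      then obtain i where i: "i \<in> A" "k i = j"
        using k by (metis bij_betw_imp_surj_on imageE lessThan_iff)
      have "\<omega> i = p ^ (4 * j)" using i A_R by (simp add: \<omega>_def)
      with vA[OF i(1)] have *: "q dvd v $ i + \<iota> * v $ pr i - \<tau> * p ^ (4 * j)" by simp
      have "p ^ (2 * (CARD('n) - 2)) dvd p ^ (4 * j + e)"
        using j by (intro le_imp_power_dvd)
      also have "p ^ (4 * j + e) dvd \<tau> * p ^ (4 * j)"
        using e(1) by (simp add: power_add mult.commute mult_dvd_mono)
      finally have "p ^ (2 * (CARD('n) - 2)) dvd \<tau> * p ^ (4 * j)" .
      from dvd_add[OF dvd_trans[OF le(1) *] this]
      have "p ^ (2 * (CARD('n) - 2)) dvd v $ i + \<iota> * v $ pr i" by simp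
      then have "v $ i = 0 \<and> v $ pr i = 0"
        by (rule pair_zero) (rule small)+
      with * have "q dvd \<tau> * p ^ (4 * j)" by simp
      moreover have "q = p ^ (2 * CARD('n) - 4 * j) * p ^ (4 * j)"
        using j by (simp add: q_def flip: power_add)
      ultimately have "p ^ (2 * CARD('n) - 4 * j) dvd \<tau>" using p by simp
      with e(2) j(2) show False by fastforce
    qed
  qed
  moreover have "v $ i = 0" for i
  proof -
    have pair: "v $ i = 0 \<and> v $ pr i = 0" if "i \<in> A" for i
    proof (rule pair_zero)
      show "p ^ (2 * (CARD('n) - 2)) dvd v $ i + \<iota> * v $ pr i"
        using vA[OF that] \<open>\<tau> = 0\<close> le(1) by (auto intro: dvd_trans)
    qed (rule small)+
    have "v $ i = 0" if "i \<in> R"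
      using vR[OF that] \<open>\<tau> = 0\<close> le(2) by (intro R_zero) (auto intro: dvd_trans)
    with pair[of i] pair[of "pr i"] cover[of i] show ?thesis by auto
  qed
  ultimately show ?thesis by (simp add: vec_eq_iff)
qed

text \<open>
  A similarity of ratio \<open>s\<close> from \<open>\<int>\<^sup>d\<close> into \<open>L 0\<close>: multiplication by the Gaussian integer \<open>x + iy\<close> on each
  pair, and by \<open>s\<close> on the unpaired coordinate. It supplies a reduced basis of the lattice.
\<close>

definition emb :: "int^'n \<Rightarrow> int^'n" where
  "emb m = (\<chi> i. if i \<in> A then x * m $ i - y * m $ pr i
                 else if i \<in> R then s * m $ i
                 else y * m $ pr i + x * m $ i)"

lemma emb_A: "i \<in> A \<Longrightarrow> emb m $ i = x * m $ i - y * m $ pr i"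
  and emb_pr: "i \<in> A \<Longrightarrow> emb m $ pr i = y * m $ i + x * m $ pr i"
  and emb_R: "i \<in> R \<Longrightarrow> emb m $ i = s * m $ i"
  using pr_notin A_R by (auto simp: emb_def)

lemma norm_emb: "(\<Sum>i\<in>UNIV. (emb m $ i)\<^sup>2) = q * (\<Sum>i\<in>UNIV. (m $ i)\<^sup>2)"
proof -
  have "(emb m $ i)\<^sup>2 + (emb m $ pr i)\<^sup>2 = q * ((m $ i)\<^sup>2 + (m $ pr i)\<^sup>2)" if "i \<in> A" for i
    unfolding emb_A[OF that] emb_pr[OF that] q_def xy[symmetric] by algebra
  moreover have "(emb m $ i)\<^sup>2 = q * (m $ i)\<^sup>2" if "i \<in> R" for i
    unfolding emb_R[OF that] q_eq by algebra
  ultimately show ?thesis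
    unfolding sum_split distrib_left sum_distrib_left by simp
qed

lemma emb_diff: "emb (m - m') = emb m - emb m'"
  by (simp add: emb_def vec_eq_iff algebra_simps)

lemma inj_emb: "inj emb"
proof (rule injI)
  fix m m' assume "emb m = emb m'"
  then have "q * (\<Sum>i\<in>UNIV. ((m - m') $ i)\<^sup>2) = 0"
    unfolding norm_emb[symmetric] emb_diff by simp
  then have "(\<Sum>i\<in>UNIV. ((m - m') $ i)\<^sup>2) = 0" using q_pos by simp
  then show "m = m'" by (subst (asm) sum_nonneg_eq_0_iff) (auto simp: vec_eq_iff)
qed

lemma emb_form: "i \<in> A \<Longrightarrow> q dvd emb m $ pr i - \<iota> * emb m $ i"
proof -
  assume i: "i \<in> A"
  have "q dvd y - \<iota> * x" "q dvd \<iota>\<^sup>2 + 1" using iota_x iota_sq by (simp_all add: q_def)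
  then have "q dvd (y - \<iota> * x) * (m $ i + \<iota> * m $ pr i) + (\<iota>\<^sup>2 + 1) * (x * m $ pr i)"
    by (rule dvd_add[OF dvd_mult2 dvd_mult2])
  also have "\<dots> = emb m $ pr i - \<iota> * emb m $ i"
    unfolding emb_A[OF i] emb_pr[OF i] by algebra
  finally show ?thesis .
qed

text \<open>
  Write \<open>n = w + u\<close> with \<open>u = emb m\<close>. Since \<open>|u|\<^sup>2 \<equiv> 0\<close>, the phase \<open>b \<bullet> n - a|n|\<^sup>2\<close> depends on \<open>u\<close> only through
  \<open>(b - 2aw) \<bullet> u\<close>. Here \<open>b - 2aw \<in> L 0\<close> because \<open>b \<in> L (2a)\<close> and \<open>w \<in> L 1\<close>, and \<open>L 0\<close> is orthogonal to
  the range of \<open>emb\<close> modulo \<open>q\<close>.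
\<close>

lemma coherence:
  assumes b: "b \<in> L (2 * a)" and w: "w \<in> L 1" and n: "n = w + emb m"
  shows "q dvd (\<Sum>i\<in>UNIV. b $ i * n $ i) - a * (\<Sum>i\<in>UNIV. (n $ i)\<^sup>2)
           - ((\<Sum>i\<in>UNIV. b $ i * w $ i) - a * (\<Sum>i\<in>UNIV. (w $ i)\<^sup>2))"
proof -
  define D where "D i = b $ i - 2 * a * w $ i" for i
  have "(\<Sum>i\<in>UNIV. b $ i * n $ i) - a * (\<Sum>i\<in>UNIV. (n $ i)\<^sup>2)
           - ((\<Sum>i\<in>UNIV. b $ i * w $ i) - a * (\<Sum>i\<in>UNIV. (w $ i)\<^sup>2))
      = (\<Sum>i\<in>UNIV. b $ i * n $ i - a * (n $ i)\<^sup>2 - (b $ i * w $ i - a * (w $ i)\<^sup>2))"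
    by (simp add: sum_subtractf sum_distrib_left)
  also have "\<dots> = (\<Sum>i\<in>UNIV. D i * emb m $ i - a * (emb m $ i)\<^sup>2)"
    by (intro sum.cong refl) (simp add: D_def n power2_eq_square algebra_simps)
  also have "\<dots> = (\<Sum>i\<in>UNIV. D i * emb m $ i) - a * (q * (\<Sum>i\<in>UNIV. (m $ i)\<^sup>2))"
    unfolding norm_emb[symmetric] by (simp add: sum_subtractf sum_distrib_left)
  finally have eq: "(\<Sum>i\<in>UNIV. b $ i * n $ i) - a * (\<Sum>i\<in>UNIV. (n $ i)\<^sup>2)
           - ((\<Sum>i\<in>UNIV. b $ i * w $ i) - a * (\<Sum>i\<in>UNIV. (w $ i)\<^sup>2))
     = (\<Sum>i\<in>UNIV. D i * emb m $ i) - a * (q * (\<Sum>i\<in>UNIV. (m $ i)\<^sup>2))" .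
  have "q dvd D i * emb m $ i + D (pr i) * emb m $ pr i" if i: "i \<in> A" for i
  proof -
    have "q dvd b $ i + \<iota> * b $ pr i - 2 * a * \<omega> i" "q dvd w $ i + \<iota> * w $ pr i - 1 * \<omega> i"
      using b w i by (auto simp: L_def)
    then have "q dvd (b $ i + \<iota> * b $ pr i - 2 * a * \<omega> i) * emb m $ i
        - (w $ i + \<iota> * w $ pr i - 1 * \<omega> i) * (2 * a * emb m $ i)
        + (emb m $ pr i - \<iota> * emb m $ i) * D (pr i)"
      by (rule dvd_add[OF dvd_diff[OF dvd_mult2 dvd_mult2] dvd_mult2[OF emb_form[OF i]]])
    also have "\<dots> = D i * emb m $ i + D (pr i) * emb m $ pr i"
      unfolding D_def by algebra
    finally show ?thesis .
  qed
  moreover have "q dvd D i * emb m $ i" if i: "i \<in> R" for i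
  proof -
    have "s dvd b $ i - 2 * a * \<omega> i" "s dvd w $ i - 1 * \<omega> i"
      using b w i by (auto simp: L_def)
    then have "s dvd (b $ i - 2 * a * \<omega> i) - (w $ i - 1 * \<omega> i) * (2 * a)"
      by (rule dvd_diff[OF _ dvd_mult2])
    also have "\<dots> = D i" by (simp add: D_def algebra_simps)
    finally show ?thesis unfolding emb_R[OF i] q_eq by (intro mult_dvd_mono) auto
  qed
  ultimately have "q dvd (\<Sum>i\<in>UNIV. D i * emb m $ i)"
    unfolding sum_split by (intro dvd_add[OF dvd_sum dvd_sum])
  then show ?thesis unfolding eq by (rule dvd_diff) simp
qed

text \<open>
  Reduction of \<open>(g, 0)\<close> modulo the square lattice spanned by \<open>(x, y)\<close> and \<open>(-y, x)\<close>: \<open>f1\<close> and \<open>f2\<close> are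
  the integer parts of its coordinates in this basis.
\<close>

lemma ex_small_pair:
  "\<exists>w1 w2. q dvd w1 + \<iota> * w2 - g \<and> w1\<^sup>2 + w2\<^sup>2 \<le> 2 * q"
proof -
  define f1 where "f1 = (g * x) div q"
  define f2 where "f2 = (- (g * y)) div q"
  define r1 where "r1 = (g * x) mod q"
  define r2 where "r2 = (- (g * y)) mod q"
  define w1 where "w1 = g - f1 * x + f2 * y"
  define w2 where "w2 = - f1 * y - f2 * x"
  have e: "g * x = f1 * q + r1" "- (g * y) = f2 * q + r2"
    unfolding f1_def r1_def f2_def r2_def by (simp_all only: div_mult_mod_eq)
  have r: "0 \<le> r1" "r1 < q" "0 \<le> r2" "r2 < q"
    using q_pos by (simp_all add: r1_def r2_def)
  have qxy: "q = x\<^sup>2 + y\<^sup>2" by (simp add: q_def xy)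
  have "w1 * x + w2 * y = r1" "- w1 * y + w2 * x = r2"
    using e unfolding w1_def w2_def qxy by algebra+
  moreover have "q * (w1\<^sup>2 + w2\<^sup>2) = (w1 * x + w2 * y)\<^sup>2 + (- w1 * y + w2 * x)\<^sup>2"
    unfolding qxy by algebra
  ultimately have "q * (w1\<^sup>2 + w2\<^sup>2) = r1\<^sup>2 + r2\<^sup>2" by simp
  also have "\<dots> \<le> q\<^sup>2 + q\<^sup>2"
    using r by (intro add_mono power_mono) auto
  finally have "q * (w1\<^sup>2 + w2\<^sup>2) \<le> q * (2 * q)"
    by (simp add: power2_eq_square)
  then have "w1\<^sup>2 + w2\<^sup>2 \<le> 2 * q" using q_pos by simp
  moreover have "q dvd w1 + \<iota> * w2 - g"
  proof -
    have "q dvd y - \<iota> * x" "q dvd \<iota>\<^sup>2 + 1" using iota_x iota_sq by (simp_all add: q_def)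
    then have "q dvd (y - \<iota> * x) * (f2 - \<iota> * f1) - (\<iota>\<^sup>2 + 1) * (f1 * x)"
      by (rule dvd_diff[OF dvd_mult2 dvd_mult2])
    also have "\<dots> = w1 + \<iota> * w2 - g"
      unfolding w1_def w2_def by algebra
    finally show ?thesis .
  qed
  ultimately show ?thesis by blast
qed

lemma ex_small_representative: "\<exists>w\<in>L 1. (\<Sum>i\<in>UNIV. (w $ i)\<^sup>2) \<le> int CARD('n) * q"
proof -
  have "\<forall>i. \<exists>w1 w2. q dvd w1 + \<iota> * w2 - \<omega> i \<and> w1\<^sup>2 + w2\<^sup>2 \<le> 2 * q"
    using ex_small_pair by blast
  then obtain f1 f2 where f: "\<And>i. q dvd f1 i + \<iota> * f2 i - \<omega> i \<and> (f1 i)\<^sup>2 + (f2 i)\<^sup>2 \<le> 2 * q"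
    unfolding choice_iff by blast
  define w :: "int^'n" where
    "w = (\<chi> i. if i \<in> A then f1 i else if i \<in> R then \<omega> i else f2 (pr i))"
  have wA: "w $ i = f1 i" "w $ pr i = f2 i" if "i \<in> A" for i
    using that pr_notin A_R by (auto simp: w_def)
  have wR: "w $ i = \<omega> i" if "i \<in> R" for i
    using that A_R by (auto simp: w_def)
  have "w \<in> L 1" using f by (simp add: L_def wA wR)
  moreover have "(\<Sum>i\<in>UNIV. (w $ i)\<^sup>2) \<le> int CARD('n) * q"
  proof -
    have "(\<omega> i)\<^sup>2 \<le> q" if "i \<in> R" for i
    proof -
      have "(\<omega> i)\<^sup>2 \<le> s\<^sup>2"
        using that p unfolding \<omega>_def s_def by (intro power_mono) (auto intro: power_increasing)
      then show ?thesis by (simp add: q_eq power2_eq_square)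
    qed
    then have "(\<Sum>i\<in>UNIV. (w $ i)\<^sup>2) \<le> (\<Sum>i\<in>A. 2 * q) + (\<Sum>i\<in>R. q)"
      unfolding sum_split using f by (intro add_mono sum_mono) (auto simp: wA wR)
    also have "\<dots> = int (2 * card A + card R) * q" by (simp add: algebra_simps)
    finally show ?thesis by (simp add: card_split)
  qed
  ultimately show ?thesis by blast
qed

text \<open>
  A coset of \<open>L 0\<close> has \<open>q\<^bsup>d/2\<^esup> = p\<^bsup>d\<cdot>d\<^esup>\<close> points per period: in each pair the second coordinate is free and
  determines the first modulo \<open>q\<close>, and an unpaired coordinate is determined modulo \<open>s\<close>.
\<close>

lemma card_translate_ge:
  "p ^ (CARD('n) * CARD('n)) \<le> card {c. (\<forall>i. 0 \<le> c $ i \<and> c $ i < q) \<and> c - e \<in> L \<tau>}"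
  (is "_ \<le> int (card ?C)")
proof -
  \<comment> \<open>\<open>X\<close> holds the free parameters; the slots in \<open>A\<close> carry none.\<close>
  define X where "X = (\<Pi>\<^sub>E i\<in>UNIV. if i \<in> A then {0} else if i \<in> R then {0..<s} else {0..<q})"
  define c where "c h = (\<chi> i. if i \<in> A then (\<tau> * \<omega> i + e $ i - \<iota> * (h (pr i) - e $ pr i)) mod q
      else if i \<in> R then (\<tau> * \<omega> i + e $ i) mod s + s * h i else h i)" for h :: "'n \<Rightarrow> int"
  have cA: "c h $ i = (\<tau> * \<omega> i + e $ i - \<iota> * (h (pr i) - e $ pr i)) mod q" "c h $ pr i = h (pr i)"
    if "i \<in> A" for h i
    using that pr_notin A_R by (auto simp: c_def)
  have cR: "c h $ i = (\<tau> * \<omega> i + e $ i) mod s + s * h i" if "i \<in> R" for h i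
    using that A_R by (auto simp: c_def)
  have X: "i \<in> A \<Longrightarrow> h i = 0" "i \<in> A \<Longrightarrow> 0 \<le> h (pr i) \<and> h (pr i) < q"
     "i \<in> R \<Longrightarrow> 0 \<le> h i \<and> h i < s" if "h \<in> X" for h i
  proof -
    have "h j \<in> (if j \<in> A then {0} else if j \<in> R then {0..<s} else {0..<q})" for j
      using that unfolding X_def by (rule PiE_mem) simp
    from this[of i] this[of "pr i"]
    show "i \<in> A \<Longrightarrow> h i = 0" "i \<in> A \<Longrightarrow> 0 \<le> h (pr i) \<and> h (pr i) < q"
     "i \<in> R \<Longrightarrow> 0 \<le> h i \<and> h i < s"
      using pr_notin[of i] A_R[of i] by (simp_all split: if_splits)
  qed
  have bij: "c h \<in> ?C" if h: "h \<in> X" for h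
  proof -
    have "0 \<le> c h $ i \<and> c h $ i < q" for i
    proof -
      consider "i \<in> A" | "pr i \<in> A" | "i \<in> R" using cover by blast
      then show ?thesis
      proof cases
        case 1
        then show ?thesis using q_pos by (simp add: cA)
      next
        case 2
        then show ?thesis using cA(2)[OF 2, of h] X(2)[OF h 2] by simp
      next
        case 3
        have "0 \<le> h i" "h i \<le> s - 1" using X(3)[OF h 3] by auto
        then have "0 \<le> s * h i" "s * h i \<le> s * (s - 1)"
          using s_pos by (auto intro: mult_left_mono)
        moreover have "0 \<le> (\<tau> * \<omega> i + e $ i) mod s" "(\<tau> * \<omega> i + e $ i) mod s < s"
          using s_pos by simp_all
        ultimately show ?thesis unfolding cR[OF 3] q_eq by (simp add: algebra_simps)
      qed
    qed
    moreover have "q dvd (c h - e) $ i + \<iota> * (c h - e) $ pr i - \<tau> * \<omega> i" if "i \<in> A" for i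
    proof -
      have "q dvd (z mod q) - z" for z :: int
        by (simp add: mod_eq_dvd_iff[symmetric])
      from this[of "\<tau> * \<omega> i + e $ i - \<iota> * (h (pr i) - e $ pr i)"]
      show ?thesis by (simp add: cA[OF that] algebra_simps)
    qed
    moreover have "s dvd (c h - e) $ i - \<tau> * \<omega> i" if "i \<in> R" for i
    proof -
      have "s dvd (z mod s) - z" for z :: int
        by (simp add: mod_eq_dvd_iff[symmetric])
      from dvd_add[OF this[of "\<tau> * \<omega> i + e $ i"], of "s * h i"]
      show ?thesis by (simp add: cR[OF that] algebra_simps)
    qed
    ultimately show ?thesis by (simp add: L_def)
  qed
  have inj: "inj_on c X"
  proof (rule inj_onI)
    fix h h' assume h: "h \<in> X" "h' \<in> X" and eq: "c h = c h'"
    have "h i = h' i" for i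
    proof -
      consider "i \<in> A" | "pr i \<in> A" | "i \<in> R" using cover by blast
      then show ?thesis
      proof cases
        case 1
        then show ?thesis using X(1)[OF h(1)] X(1)[OF h(2)] by simp
      next
        case 2
        then show ?thesis using cA(2)[OF 2, of h] cA(2)[OF 2, of h'] eq by simp
      next
        case 3
        then show ?thesis using cR[OF 3, of h] cR[OF 3, of h'] eq s_pos by simp
      qed
    qed
    then show "h = h'" by auto
  qed
  have "finite ?C" by (rule finite_subset[OF _ finite_cube[of 0 q]]) auto
  then have "card X \<le> card ?C"
    using bij inj by (intro card_inj_on_le[of c]) auto
  moreover have "int (card X) = p ^ (CARD('n) * CARD('n))"
  proof -
    have "int (card X) = (\<Prod>i\<in>UNIV. int (card (if i \<in> A then {0} else if i \<in> R then {0..<s} else {0..<q})))"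
      unfolding X_def by (simp add: card_PiE)
    also have "\<dots> = (\<Prod>i\<in>A. q) * (\<Prod>i\<in>R. s)"
      unfolding prod_split using pr_notin A_R q_pos s_pos
      by (intro arg_cong2[of _ _ _ _ "(*)"] prod.cong refl) auto
    also have "\<dots> = p ^ (CARD('n) * (2 * card A + card R))"
      by (simp add: q_def s_def algebra_simps flip: power_mult power_add)
    finally show ?thesis by (simp add: card_split)
  qed
  ultimately show ?thesis by linarith
qed

text \<open>
  The good cells are in bijection with triples of a time, a displacement and a coherent point: by
  \<open>separation\<close>, two different time-displacement pairs never lead to the same cell.
\<close>

lemma card_resonant_points_ge:
  fixes T H :: int
  assumes T: "2 * T < q" and H: "2 * (H - 1) < p ^ (CARD('n) - 2)" "H \<ge> 1" "T \<ge> 1"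
  defines "G \<equiv> {c. (\<forall>i. 0 \<le> c $ i \<and> c $ i < q) \<and>
     (\<exists>a\<in>{1..T}. \<exists>b\<in>L (2 * a). \<forall>i. b $ i \<le> c $ i \<and> c $ i - b $ i < H)}"
  shows "T * H ^ CARD('n) * p ^ (CARD('n) * CARD('n)) \<le> card G"
proof -
  define Q where "Q = {1..T} \<times> {e :: int^'n. \<forall>i. 0 \<le> e $ i \<and> e $ i < H}"
  define C where "C = (\<lambda>(a, e). {c. (\<forall>i. 0 \<le> c $ i \<and> c $ i < q) \<and> c - e \<in> L (2 * a)})"
  have finQ: "finite Q" unfolding Q_def by (intro finite_cartesian_product finite_cube) auto
  have finC: "finite (C z)" for z
    by (rule finite_subset[OF _ finite_cube[of 0 q]]) (auto simp: C_def split: prod.splits)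
  have G: "G = (\<Union>z\<in>Q. C z)"
  proof (intro equalityI subsetI)
    fix c assume "c \<in> G"
    then obtain a b where c: "\<forall>i. 0 \<le> c $ i \<and> c $ i < q" "a \<in> {1..T}" "b \<in> L (2 * a)"
      "\<forall>i. b $ i \<le> c $ i \<and> c $ i - b $ i < H" by (auto simp: G_def)
    then have "(a, c - b) \<in> Q" "c \<in> C (a, c - b)" by (auto simp: Q_def C_def)
    then show "c \<in> (\<Union>z\<in>Q. C z)" by blast
  next
    fix c assume "c \<in> (\<Union>z\<in>Q. C z)"
    then obtain a e where c: "a \<in> {1..T}" "\<forall>i. 0 \<le> e $ i \<and> e $ i < H"
      "\<forall>i. 0 \<le> c $ i \<and> c $ i < q" "c - e \<in> L (2 * a)" by (auto simp: Q_def C_def)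
    then show "c \<in> G" unfolding G_def by (auto intro!: bexI[of _ a] bexI[of _ "c - e"])
  qed
  have disj: "C z \<inter> C z' = {}" if z: "z \<in> Q" "z' \<in> Q" "z \<noteq> z'" for z z'
  proof (rule ccontr)
    assume "C z \<inter> C z' \<noteq> {}"
    then obtain c where c: "c \<in> C z" "c \<in> C z'" by auto
    obtain a e a' e' where zz: "z = (a, e)" "z' = (a', e')" by (metis surj_pair)
    have "c - e \<in> L (2 * a)" "c - e' \<in> L (2 * a')" using c by (auto simp: zz C_def)
    then have "e' - e \<in> L (2 * a - 2 * a')"
      unfolding L_def mem_Collect_eq
    proof (intro conjI ballI; elim conjE)
      fix i assume "i \<in> A" "\<forall>i\<in>A. q dvd (c - e) $ i + \<iota> * (c - e) $ pr i - 2 * a * \<omega> i"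
        "\<forall>i\<in>A. q dvd (c - e') $ i + \<iota> * (c - e') $ pr i - 2 * a' * \<omega> i"
      then have "q dvd ((c - e) $ i + \<iota> * (c - e) $ pr i - 2 * a * \<omega> i) - ((c - e') $ i + \<iota> * (c - e') $ pr i - 2 * a' * \<omega> i)"
        by (metis dvd_diff)
      then show "q dvd (e' - e) $ i + \<iota> * (e' - e) $ pr i - (2 * a - 2 * a') * \<omega> i"
        by (simp add: algebra_simps)
    next
      fix i assume "i \<in> R" "\<forall>i\<in>R. s dvd (c - e) $ i - 2 * a * \<omega> i"
        "\<forall>i\<in>R. s dvd (c - e') $ i - 2 * a' * \<omega> i"
      then have "s dvd ((c - e) $ i - 2 * a * \<omega> i) - ((c - e') $ i - 2 * a' * \<omega> i)"
        by (metis dvd_diff)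
      then show "s dvd (e' - e) $ i - (2 * a - 2 * a') * \<omega> i"
        by (simp add: algebra_simps)
    qed
    moreover have "\<bar>2 * a - 2 * a'\<bar> < q"
      using z T by (auto simp: zz Q_def)
    moreover have "2 * \<bar>(e' - e) $ i\<bar> < p ^ (CARD('n) - 2)" for i
    proof -
      have "0 \<le> e $ i \<and> e $ i < H" "0 \<le> e' $ i \<and> e' $ i < H"
        using z by (auto simp: zz Q_def)
      then have "\<bar>(e' - e) $ i\<bar> \<le> H - 1" by auto
      then have "2 * \<bar>(e' - e) $ i\<bar> \<le> 2 * (H - 1)" by simp
      then show ?thesis using H(1) by (rule le_less_trans)
    qed
    ultimately have "2 * a - 2 * a' = 0 \<and> e' - e = 0" by (rule separation)
    then show False using z(3) by (simp add: zz)
  qed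
  have "T * H ^ CARD('n) * p ^ (CARD('n) * CARD('n)) = (\<Sum>z\<in>Q. p ^ (CARD('n) * CARD('n)))"
    using H by (simp add: Q_def card_cartesian_product card_cube)
  also have "\<dots> \<le> (\<Sum>z\<in>Q. int (card (C z)))"
    unfolding C_def by (intro sum_mono) (auto intro: card_translate_ge split: prod.splits)
  also have "\<dots> = int (card G)"
    unfolding G using card_UN_disjoint[OF finQ, of C] finC disj by auto
  finally show ?thesis .
qed

text \<open>
  The offset \<open>4K\<close> of the parameter cube puts the frequencies into a dyadic annulus: \<open>|emb m|\<close> lies between
  \<open>4K\<surd>d p\<^sup>d\<close> and \<open>5K\<surd>d p\<^sup>d\<close>, and the translation by \<open>w\<close> costs at most \<open>K\<surd>d p\<^sup>d\<close>.
\<close>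

lemma ex_frequencies:
  fixes K :: nat
  assumes K: "K \<ge> 1" and w: "w \<in> L 1" "(\<Sum>i\<in>UNIV. (w $ i)\<^sup>2) \<le> int CARD('n) * q"
  defines "S \<equiv> (\<lambda>m. w + emb m) ` {m. \<forall>i. 4 * int K \<le> m $ i \<and> m $ i < 5 * int K}"
  shows "finite S" "card S = K ^ CARD('n)"
    and "\<And>n. n \<in> S \<Longrightarrow> 3 * K * sqrt CARD('n) * p ^ CARD('n) \<le> norm (freq n) \<and> norm (freq n) \<le> 6 * K * sqrt CARD('n) * p ^ CARD('n)"
proof -
  show "finite S" unfolding S_def by (intro finite_imageI finite_cube)
  have "inj (\<lambda>m. w + emb m)" using inj_emb by (auto simp: inj_def)
  then show "card S = K ^ CARD('n)"
    unfolding S_def by (subst card_image) (auto simp: card_cube intro: inj_on_subset)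
  fix n assume "n \<in> S"
  then obtain m where m: "\<And>i. 4 * int K \<le> m $ i \<and> m $ i < 5 * int K" and n: "n = w + emb m"
    by (auto simp: S_def)
  have nf: "norm (freq v) = sqrt (of_int (\<Sum>i\<in>UNIV. (v $ i)\<^sup>2))" for v :: "int^'n"
  proof -
    have "(norm (freq v))\<^sup>2 = of_int (\<Sum>i\<in>UNIV. (v $ i)\<^sup>2)"
      unfolding norm_squared_vec by (simp add: freq_def)
    then show ?thesis by (metis norm_ge_zero real_sqrt_unique)
  qed
  have sq: "sqrt (of_int q) = of_int s"
    using s_pos by (simp add: q_eq)
  have "norm (freq w) \<le> sqrt (of_int (int CARD('n) * q))"
    unfolding nf using w(2) by (intro real_sqrt_le_mono) (simp only: of_int_le_iff)
  also have "\<dots> = sqrt CARD('n) * s" by (simp add: real_sqrt_mult sq)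
  also have "\<dots> \<le> K * sqrt CARD('n) * s" using K s_pos by simp
  finally have nw: "norm (freq w) \<le> K * sqrt CARD('n) * s" .
  have "(\<Sum>i\<in>(UNIV :: 'n set). (4 * int K)\<^sup>2) \<le> (\<Sum>i\<in>UNIV. (m $ i)\<^sup>2)"
    using m by (intro sum_mono power_mono) auto
  moreover have "(\<Sum>i\<in>UNIV. (m $ i)\<^sup>2) \<le> (\<Sum>i\<in>(UNIV :: 'n set). (5 * int K)\<^sup>2)"
  proof (intro sum_mono power_mono)
    show "m $ i \<le> 5 * int K" "0 \<le> m $ i" for i using m[of i] by auto
  qed
  ultimately have "q * (int CARD('n) * (4 * int K)\<^sup>2) \<le> (\<Sum>i\<in>UNIV. (emb m $ i)\<^sup>2)"
    "(\<Sum>i\<in>UNIV. (emb m $ i)\<^sup>2) \<le> q * (int CARD('n) * (5 * int K)\<^sup>2)"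
    unfolding norm_emb using q_pos by simp_all
  then have "sqrt (of_int (q * (int CARD('n) * (4 * int K)\<^sup>2))) \<le> norm (freq (emb m))"
    "norm (freq (emb m)) \<le> sqrt (of_int (q * (int CARD('n) * (5 * int K)\<^sup>2)))"
    unfolding nf by (intro real_sqrt_le_mono; simp only: of_int_le_iff)+
  moreover have "sqrt (of_int (q * (int CARD('n) * (int c * int K)\<^sup>2))) = c * (K * sqrt CARD('n) * s)" for c :: nat
    by (simp add: real_sqrt_mult sq)
  from this[of 4] this[of 5]
  have "sqrt (of_int (q * (int CARD('n) * (4 * int K)\<^sup>2))) = 4 * (K * sqrt CARD('n) * s)"
    "sqrt (of_int (q * (int CARD('n) * (5 * int K)\<^sup>2))) = 5 * (K * sqrt CARD('n) * s)" by simp_all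
  ultimately have "4 * (K * sqrt CARD('n) * s) \<le> norm (freq (emb m))" "norm (freq (emb m)) \<le> 5 * (K * sqrt CARD('n) * s)"
    by simp_all
  moreover have "norm (freq n) \<le> norm (freq w) + norm (freq (emb m))" "norm (freq (emb m)) - norm (freq w) \<le> norm (freq n)"
    unfolding n freq_add by (rule norm_triangle_ineq, metis norm_diff_ineq add.commute)
  ultimately have "3 * (K * sqrt CARD('n) * s) \<le> norm (freq n)" "norm (freq n) \<le> 6 * (K * sqrt CARD('n) * s)"
    using nw by linarith+
  then show "3 * K * sqrt CARD('n) * p ^ CARD('n) \<le> norm (freq n) \<and> norm (freq n) \<le> 6 * K * sqrt CARD('n) * p ^ CARD('n)"
    by (simp add: s_def mult.assoc)
qed

end

section \<open>The counterexample at a single scale\<close>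

text \<open>
  The witnesses are the powers of \<open>2 + i\<close>: multiplication by \<open>2 + i\<close> preserves the congruence
  \<open>y \<equiv> 3x\<close> modulo \<open>5\<close>, which keeps \<open>x\<close> prime to \<open>5\<close>.
\<close>

lemma sum_of_two_squares_power_5:
  "\<exists>x y :: int. x\<^sup>2 + y\<^sup>2 = 5 ^ Suc m \<and> \<not> 5 dvd x \<and> 5 dvd y - 3 * x"
proof (induction m)
  case 0
  show ?case by (intro exI[of _ 2] exI[of _ 1]) simp
next
  case (Suc m)
  then obtain x y :: int where xy: "x\<^sup>2 + y\<^sup>2 = 5 ^ Suc m" "\<not> 5 dvd x" "5 dvd y - 3 * x"
    by blast
  have "(2 * x - y)\<^sup>2 + (x + 2 * y)\<^sup>2 = 5 * (x\<^sup>2 + y\<^sup>2)" by algebra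
  moreover have "\<not> 5 dvd 2 * x - y" "5 dvd (x + 2 * y) - 3 * (2 * x - y)"
    using xy(2,3) by presburger+
  ultimately show ?case
    using xy(1) by (intro exI[of _ "2 * x - y"] exI[of _ "x + 2 * y"]) simp
qed

lemma ex_resonant_lattice:
  assumes "CARD('n::finite) \<ge> 2" "j \<ge> 1"
  shows "\<exists>(pr :: 'n \<Rightarrow> 'n) A R x y \<iota> k. resonant_lattice pr A R (5 ^ j) x y \<iota> k"
proof -
  define Q :: int where "Q = (5 ^ j) ^ (2 * CARD('n))"
  obtain pr :: "'n \<Rightarrow> 'n" and A R where pr: "paired_coordinates pr A R" and R: "card R \<le> 1"
    using ex_paired_coordinates by blast
  obtain k where k: "bij_betw k A {..<card A}"
    using ex_bij_betw_finite_nat[of A] by (auto simp: atLeast0LessThan)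
  obtain m where m: "j * (2 * CARD('n)) = Suc m"
    using assms by (cases "j * (2 * CARD('n))") auto
  then have Q: "Q = 5 ^ Suc m" by (simp only: Q_def power_mult[symmetric])
  obtain x y :: int where xy: "x\<^sup>2 + y\<^sup>2 = 5 ^ Suc m" "\<not> 5 dvd x"
    using sum_of_two_squares_power_5 by blast
  have "coprime x 5"
    using xy(2) prime_imp_coprime[of 5 x] by (simp add: coprime_commute)
  then have cop: "coprime x Q" unfolding Q by simp
  then obtain u v where uv: "u * x + v * Q = 1"
    using bezout_int[of x Q] by auto
  have 1: "Q dvd y - (u * y) * x"
  proof
    have "y - (u * y) * x = (u * x + v * Q) * y - (u * y) * x" by (simp add: uv)
    then show "y - (u * y) * x = Q * (v * y)" by (simp add: algebra_simps)
  qed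
  have 2: "Q dvd (u * y)\<^sup>2 + 1"
  proof -
    have "x\<^sup>2 * ((u * y)\<^sup>2 + 1) = (u * x)\<^sup>2 * y\<^sup>2 + x\<^sup>2"
      by algebra
    also have "u * x = 1 - v * Q" using uv by simp
    also have "(1 - v * Q)\<^sup>2 * y\<^sup>2 + x\<^sup>2 = (x\<^sup>2 + y\<^sup>2) + Q * (v * (v * Q - 2) * y\<^sup>2)"
      by algebra
    also have "x\<^sup>2 + y\<^sup>2 = Q" by (simp only: xy(1) Q)
    finally have "Q dvd x\<^sup>2 * ((u * y)\<^sup>2 + 1)" by simp
    moreover have "coprime Q (x\<^sup>2)" using cop by (simp add: coprime_commute)
    ultimately show ?thesis by (simp add: coprime_dvd_mult_right_iff)
  qed
  have "(5::int) ^ j \<ge> 5 ^ 1" using assms(2) by (intro power_increasing) auto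
  then have "resonant_lattice pr A R (5 ^ j) x y (u * y) k"
    using pr R k xy(1)[folded Q] 1 2 assms(1) unfolding Q_def
    by (simp add: resonant_lattice_def resonant_lattice_axioms_def)
  then show ?thesis by blast
qed

text \<open>
  With \<open>p = 5\<^sup>j\<close>, \<open>q = p\<^sup>2\<^sup>d\<close>, about \<open>q/16\<close> times and about \<open>(p\<^bsup>d-2\<^esup>/2)\<^sup>d\<close> displacements, the number of good cells is
  at least a constant times \<open>p\<^sup>2\<^sup>d \<cdot> p\<^bsup>d(d-2)\<^esup> \<cdot> p\<^bsup>d\<cdot>d\<^esup> = q\<^sup>d\<close>. The bound on \<open>K\<close> keeps the frequencies
  below a small multiple of the inverse of the displacement size \<open>p\<^bsup>d-2\<^esup>/q\<close>.
\<close>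

lemma maximal_counterexample_at_scale:
  fixes j K :: nat
  assumes dim: "CARD('n::finite) \<ge> 2" and j: "j \<ge> 1" and K: "K \<ge> 1"
    and JK: "36 * CARD('n) * K \<le> (5 ^ j) ^ 2"
  defines "N \<equiv> 3 * real K * sqrt (CARD('n)) * (5 ^ j) ^ CARD('n)"
  shows "\<exists>(F :: real^'n \<Rightarrow> complex) (B :: real set).
     trig_polynomial F \<and> finite B \<and> B \<noteq> {} \<and> B \<subseteq> {0<..1/2} \<and>
     {n. fourier_coeff F n \<noteq> 0} \<subseteq> {n. N \<le> norm (freq n) \<and> norm (freq n) \<le> 2 * N} \<and>
     L2_norm_torus F = 1 \<and>
     1 / (32 * 2 ^ CARD('n)) \<le> measure haar_torus
        {x \<in> torus_box. sqrt (K ^ CARD('n)) / 2 \<le> Max ((\<lambda>t. cmod (schrodinger t F x)) ` B)}"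
proof -
  obtain pr :: "'n \<Rightarrow> 'n" and A R x y \<iota> k where "resonant_lattice pr A R (5 ^ j) x y \<iota> k"
    using ex_resonant_lattice[OF dim j] by blast
  then interpret resonant_lattice pr A R "5 ^ j" x y \<iota> k .
  define p :: int where "p = 5 ^ j"
  define P where "P = p ^ (CARD('n) - 2)"
  \<comment> \<open>Dividing by \<open>16 > 4\<pi>\<close> keeps the times \<open>2\<pi>a/q\<close>, \<open>a \<le> T\<close>, below \<open>1/2\<close>.\<close>
  define T where "T = q div 16"
  define H where "H = (P + 1) div 2"
  have p5: "p \<ge> 5"
    using power_increasing[OF j, of "5::int"] by (simp add: p_def)
  have q: "q = p ^ (2 * CARD('n))" by (simp add: q_def p_def)
  have "p ^ 4 \<le> q" unfolding q using dim p5 by (intro power_increasing) auto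
  moreover have "5 ^ 4 \<le> p ^ 4" using p5 by (intro power_mono) auto
  ultimately have q625: "q \<ge> 625" by simp
  have T: "T \<ge> 1" "2 * T < q" "16 * T \<le> q" "q \<le> 32 * T"
    using q625 unfolding T_def by linarith+
  have P: "P \<ge> 1" using p5 by (simp add: P_def)
  have H: "H \<ge> 1" "2 * (H - 1) < P" "H \<le> P" "P \<le> 2 * H"
    using P unfolding H_def by presburger+
  obtain w where w: "w \<in> L 1" "(\<Sum>i\<in>UNIV. (w $ i)\<^sup>2) \<le> int CARD('n) * q"
    using ex_small_representative by blast
  define S where "S = (\<lambda>m. w + emb m) ` {m. \<forall>i. 4 * int K \<le> m $ i \<and> m $ i < 5 * int K}"
  note S = ex_frequencies[OF K w, folded S_def]
  have S0: "S \<noteq> {}" using S(1,2) K by auto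
  have annulus: "N \<le> norm (freq n) \<and> norm (freq n) \<le> 2 * N" if "n \<in> S" for n
    using S(3)[OF that] by (simp add: N_def)
  define G where "G = {c. (\<forall>i. 0 \<le> c $ i \<and> c $ i < q) \<and>
     (\<exists>a\<in>{1..T}. \<exists>b\<in>L (2 * a). \<forall>i. b $ i \<le> c $ i \<and> c $ i - b $ i < H)}"
  have "T * H ^ CARD('n) * p ^ (CARD('n) * CARD('n)) \<le> card G"
    using card_resonant_points_ge[OF T(2) H(2)[unfolded P_def p_def] H(1) T(1)] unfolding G_def p_def .
  define F :: "real^'n \<Rightarrow> complex"
    where "F = (\<lambda>x. \<Sum>n\<in>S. of_real (1 / sqrt (card S)) * exp (\<i> * of_real (freq n \<bullet> x)))"
  define B where "B = (\<lambda>a. 2 * pi * a / q) ` real_of_int ` {1..T}"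
  have "card G / q ^ CARD('n)
    \<le> measure haar_torus {x \<in> torus_box. sqrt (card S) / 2 \<le> Max ((\<lambda>t. cmod (schrodinger t F x)) ` B)}"
    unfolding F_def B_def
  proof (rule large_maximal_function[OF S(1) S0, where H = H and M = "2 * N"])
    show "q > 0" "T > 0" using q625 T by auto
    show "0 \<le> c $ i \<and> c $ i < q" if "c \<in> G" for c i using that by (simp add: G_def)
    show "norm (freq n) \<le> 2 * N" if "n \<in> S" for n using annulus[OF that] by simp
    show "\<exists>a\<in>{1..T}. \<exists>b \<theta>. (\<forall>i. b $ i \<le> c $ i \<and> c $ i - b $ i < H) \<and>
       (\<forall>n\<in>S. q dvd (\<Sum>i\<in>UNIV. b $ i * n $ i) - a * (\<Sum>i\<in>UNIV. (n $ i)\<^sup>2) - \<theta>)"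
      if c: "c \<in> G" for c
    proof -
      obtain a b where ab: "a \<in> {1..T}" "b \<in> L (2 * a)" "\<forall>i. b $ i \<le> c $ i \<and> c $ i - b $ i < H"
        using c by (auto simp: G_def)
      have "\<forall>n\<in>S. q dvd (\<Sum>i\<in>UNIV. b $ i * n $ i) - a * (\<Sum>i\<in>UNIV. (n $ i)\<^sup>2)
          - ((\<Sum>i\<in>UNIV. b $ i * w $ i) - a * (\<Sum>i\<in>UNIV. (w $ i)\<^sup>2))"
        using coherence[OF ab(2) w(1)] unfolding S_def by blast
      with ab(1,3) show ?thesis by blast
    qed
    have "6 * (2 * N) * sqrt (CARD('n)) * H = real_of_int ((36 * CARD('n) * K) * (p ^ CARD('n) * H))"
      by (simp add: N_def p_def)
    also have "(36 * CARD('n) * K) * (p ^ CARD('n) * H) \<le> p ^ 2 * (p ^ CARD('n) * P)"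
    proof (intro mult_mono)
      have "int (36 * CARD('n) * K) \<le> int ((5 ^ j) ^ 2)" using JK by (simp only: of_nat_le_iff)
      then show "int (36 * CARD('n) * K) \<le> p ^ 2" by (simp add: p_def)
    qed (use p5 H in auto)
    also have "p ^ 2 * (p ^ CARD('n) * P) = q"
      unfolding P_def q power_add[symmetric] using dim by (intro arg_cong[of _ _ "(^) p"]) simp
    finally show "6 * (2 * N) * sqrt (CARD('n)) * H \<le> q" by simp
  qed
  moreover have "1 / (32 * 2 ^ CARD('n)) \<le> card G / q ^ CARD('n)"
  proof -
    have "q * P ^ CARD('n) * p ^ (CARD('n) * CARD('n))
        \<le> (32 * T) * (2 * H) ^ CARD('n) * p ^ (CARD('n) * CARD('n))"
      using T H P p5 by (intro mult_mono power_mono) auto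
    also have "\<dots> = 32 * 2 ^ CARD('n) * (T * H ^ CARD('n) * p ^ (CARD('n) * CARD('n)))"
      by (simp add: power_mult_distrib)
    also have "\<dots> \<le> 32 * 2 ^ CARD('n) * int (card G)"
      using \<open>_ \<le> int (card G)\<close> by (intro mult_left_mono) auto
    also have "q * P ^ CARD('n) * p ^ (CARD('n) * CARD('n)) = q ^ CARD('n)"
    proof -
      obtain e where e: "CARD('n) = e + 2" using dim by (metis add.commute le_Suc_ex)
      show ?thesis
        unfolding P_def q power_mult[symmetric] power_add[symmetric] unfolding e
        by (intro arg_cong[of _ _ "(^) p"]) (simp add: algebra_simps)
    qed
    finally have "real_of_int (q ^ CARD('n)) \<le> real_of_int (32 * 2 ^ CARD('n) * int (card G))"
      by (simp only: of_int_le_iff)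
    then show ?thesis using q625 by (simp add: field_simps)
  qed
  ultimately have large: "1 / (32 * 2 ^ CARD('n)) \<le> measure haar_torus
        {x \<in> torus_box. sqrt (K ^ CARD('n)) / 2 \<le> Max ((\<lambda>t. cmod (schrodinger t F x)) ` B)}"
    unfolding S(2) by (rule order_trans[rotated])
  have "trig_polynomial F"
    unfolding trig_polynomial_def F_def
    by (rule exI[of _ S], rule exI[of _ "\<lambda>n. of_real (1 / sqrt (card S))"]) (simp only: S(1) simp_thms)
  moreover have "finite B" "B \<noteq> {}" using T by (auto simp: B_def)
  moreover have "B \<subseteq> {0<..1/2}"
  proof
    fix t assume "t \<in> B"
    then obtain a where a: "a \<in> {1..T}" "t = 2 * pi * a / q" by (auto simp: B_def)
    have "(4 * pi) * real_of_int a \<le> 16 * real_of_int T"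
      using pi_less_4 a(1) by (intro mult_mono) auto
    also have "\<dots> \<le> q" using T(3) by linarith
    finally have "2 * pi * a / q \<le> 1 / 2" using q625 by (simp add: field_simps)
    moreover have "0 < 2 * pi * a / q" using a(1) q625 by simp
    ultimately show "t \<in> {0<..1/2}" by (simp add: a(2))
  qed
  moreover have "{n. fourier_coeff F n \<noteq> 0} \<subseteq> {n. N \<le> norm (freq n) \<and> norm (freq n) \<le> 2 * N}"
    unfolding F_def fourier_coeff_trig_sum[OF S(1)] using annulus by (simp add: subset_eq)
  moreover have "L2_norm_torus F = 1"
    unfolding F_def L2_norm_trig_sum[OF S(1)]
    using S(1) S0 by (simp add: norm_divide power_divide card_gt_0_iff)
  ultimately show ?thesis
    using large by (intro exI[of _ F] exI[of _ B] conjI)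
qed

lemma linear_le_power_25: "36 * n \<le> 25 ^ (n + 1)" for n :: nat
proof (induction n)
  case (Suc n)
  have "1 \<le> (25::nat) ^ n" by simp
  moreover have "36 * n \<le> 25 * 25 ^ n" using Suc by simp
  ultimately have "36 + 36 * n \<le> 625 * 25 ^ n" by linarith
  then show ?case by simp
qed simp

theorem proposition2p1:
  assumes "CARD('n::finite) \<ge> 2"
  shows "\<exists>c b :: real. c > 0 \<and> b > 0 \<and>
    (\<exists>N :: nat \<Rightarrow> real. (\<forall>k. N k > 0) \<and> \<not> bdd_above (range N) \<and>
      (\<forall>k. \<exists>(F :: real ^ 'n \<Rightarrow> complex) (B :: real set).
         trig_polynomial F \<and>
         finite B \<and> B \<noteq> {} \<and> B \<subseteq> {0<..1/2} \<and>
         {n. fourier_coeff F n \<noteq> 0} \<subseteq> {n. N k \<le> norm (freq n) \<and> norm (freq n) \<le> 2 * N k} \<and>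
         L2_norm_torus F = 1 \<and>
         measure haar_torus
           {x \<in> torus_box. Max ((\<lambda>t. cmod (schrodinger t F x)) ` B)
              \<ge> c * N k powr (real CARD('n) / (real CARD('n) + 2))} \<ge> b))"
proof -
  let ?d = "CARD('n)"
  let ?r = "real ?d / (real ?d + 2)"
  \<comment> \<open>The scale \<open>N i\<close> comes from \<open>K = 25\<^sup>i\<close> and \<open>p = 5\<^bsup>i+d+1\<^esup>\<close>, so that \<open>p\<^sup>2 = 25\<^bsup>d+1\<^esup> K\<close> with
     \<open>25\<^bsup>d+1\<^esup> \<ge> 36d\<close>, and the amplitude \<open>K\<^bsup>d/2\<^esup> = 5\<^bsup>id\<^esup>\<close> is exactly \<open>(N i / C)\<^bsup>d/(d+2)\<^esup>\<close>.\<close>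
  define C where "C = 3 * sqrt ?d * 5 ^ ((?d + 1) * ?d)"
  define N where "N i = C * (5 ^ i) ^ (?d + 2)" for i :: nat
  have C: "C \<ge> 1"
  proof -
    have "1 \<le> sqrt ?d" by simp
    moreover have "(1::real) \<le> 5 ^ ((?d + 1) * ?d)" by simp
    ultimately have "1 * 1 \<le> sqrt ?d * 5 ^ ((?d + 1) * ?d)" by (intro mult_mono) auto
    then show ?thesis by (simp add: C_def)
  qed
  have pos: "N i > 0" for i using C by (simp add: N_def)
  have unbounded: "\<not> bdd_above (range N)"
  proof
    assume "bdd_above (range N)"
    then obtain M where M: "\<And>i. N i \<le> M" by (auto simp: bdd_above_def)
    obtain i where i: "M < 5 ^ i" using real_arch_pow[of 5 M] by auto
    have "(5::real) ^ i \<le> (5 ^ i) ^ (?d + 2)" by (rule self_le_power) auto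
    also have "\<dots> \<le> N i" using C by (simp add: N_def)
    finally show False using i M[of i] by simp
  qed
  have scale: "1 / (2 * C powr ?r) * N i powr ?r = sqrt (real ((25 ^ i) ^ ?d)) / 2" for i
  proof -
    have "((5 ^ i) ^ (?d + 2) :: real) powr ?r = (5 ^ i) ^ ?d"
    proof -
      have "((5 ^ i) ^ (?d + 2) :: real) powr ?r = ((5 ^ i) powr real (?d + 2)) powr ?r"
        by (subst powr_realpow) simp_all
      also have "\<dots> = (5 ^ i) powr (real (?d + 2) * ?r)"
        by (rule powr_powr)
      also have "real (?d + 2) * ?r = real ?d"
        by (simp add: nonzero_divide_eq_eq[of "real ?d + 2"] add_nonneg_eq_0_iff add.commute)
      also have "((5::real) ^ i) powr real ?d = (5 ^ i) ^ ?d"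
        by (rule powr_realpow) simp
      finally show ?thesis .
    qed
    moreover have "sqrt (real ((25 ^ i) ^ ?d)) = (5 ^ i) ^ ?d"
      by (rule real_sqrt_unique) (simp_all add: power2_eq_square flip: power_mult_distrib)
    ultimately show ?thesis using C by (simp add: N_def powr_mult)
  qed
  have example: "\<exists>(F :: real^'n \<Rightarrow> complex) (B :: real set).
     trig_polynomial F \<and> finite B \<and> B \<noteq> {} \<and> B \<subseteq> {0<..1/2} \<and>
     {n. fourier_coeff F n \<noteq> 0} \<subseteq> {n. N i \<le> norm (freq n) \<and> norm (freq n) \<le> 2 * N i} \<and>
     L2_norm_torus F = 1 \<and>
     measure haar_torus
        {x \<in> torus_box. Max ((\<lambda>t. cmod (schrodinger t F x)) ` B) \<ge> 1 / (2 * C powr ?r) * N i powr ?r}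
      \<ge> 1 / (32 * 2 ^ ?d)" for i
  proof -
    have "36 * ?d * 25 ^ i \<le> 25 ^ (?d + 1) * 25 ^ i"
      using linear_le_power_25[of ?d] by simp
    also have "\<dots> = ((5 ^ (i + ?d + 1)) ^ 2 :: nat)"
      by (simp only: power2_eq_square power_mult_distrib[symmetric] power_add[symmetric]) (simp add: ac_simps)
    finally have JK: "36 * ?d * 25 ^ i \<le> (5 ^ (i + ?d + 1)) ^ 2" .
    have N: "N i = 3 * real (25 ^ i) * sqrt ?d * (5 ^ (i + ?d + 1)) ^ ?d"
    proof -
      have "real (25 ^ i) = (5 ^ i) ^ 2" by (simp add: power2_eq_square flip: power_mult_distrib)
      moreover have "(5 ^ (i + ?d + 1)) ^ ?d = ((5::real) ^ i) ^ ?d * 5 ^ ((?d + 1) * ?d)"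
        by (simp add: power_add power_mult_distrib flip: power_mult)
      ultimately show ?thesis by (simp add: N_def C_def power_add power2_eq_square)
    qed
    show ?thesis
      unfolding scale unfolding N
      by (rule maximal_counterexample_at_scale[OF assms _ _ JK]) simp_all
  qed
  show ?thesis
  proof (rule exI[of _ "1 / (2 * C powr ?r)"], rule exI[of _ "1 / (32 * 2 ^ ?d)"],
      intro conjI exI[of _ N] allI)
    show "1 / (2 * C powr ?r) > 0" using C by simp
  qed (simp_all only: pos unbounded example not_False_eq_True, simp)
qed

end
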